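(* If $G$ is a finite group, then $\mathbf{FS}_G^{\mathrm{op}}$ is quasi-Gröbner. In particular, if $\mathbf{k}$ is a left-noetherian ring, then $\mathrm{Rep}_{\mathbf{k}}(\mathbf{FS}_G^{\mathrm{op}})$ is noetherian.
   Context: A $G$-map $R \to S$ between finite sets is a pair $(f,\rho)$ of functions $f\colon R \to S$ and $\rho\colon R \to G$. The composition of $(f,\rho)\colon R\to S$ followed by $(g,\sigma)\colon S\to T$ is $(g\circ f,\tau)$ with $\tau(x)=\sigma(f(x))\rho(x)$. The category $\mathbf{FS}_G$ has finite sets as objects and as morphisms the $G$-maps $(f,\rho)$ with $f$ surjective. For an essentially small category $\mathcal{C}$ and a nonzero (not necessarily commutative) ring $\mathbf{k}$, $\mathrm{Rep}_{\mathbf{k}}(\mathcal{C})$ is the abelian category of functors from $\mathcal{C}$ to left $\mathbf{k}$-modules. The principal projective at $x$ is $P_x(y)=\mathbf{k}[\mathrm{Hom}(x,y)]$. A representation is finitely generated if it is a quotient of a finite direct sum of principal projectives, and noetherian if every ascending chain of subrepresentations stabilizes. $\mathrm{Rep}_{\mathbf{k}}(\mathcal{C})$ is noetherian if every finitely generated object in it is noetherian. Property (F): a functor $\Phi\colon\mathcal{C}'\to\mathcal{C}$ satisfies property (F) if for every object $x$ of $\mathcal{C}$ there exist finitely many objects $y_1,\dots,y_n$ of $\mathcal{C}'$ and morphisms $f_i\colon x\to\Phi(y_i)$ in $\mathcal{C}$ such that for any object $y$ of $\mathcal{C}'$ and any morphism $f\colon x\to\Phi(y)$ there exist an $i$ and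 a morphism $g\colon y_i\to y$ in $\mathcal{C}'$ with $f=\Phi(g)\circ f_i$. Gröbner and quasi-Gröbner: for an object $x$ of $\mathcal{C}$ let $S_x\colon\mathcal{C}\to\mathbf{Set}$, $S_x(y)=\mathrm{Hom}(x,y)$. An ordering on $S_x$ is a choice of well-order on each $S_x(y)$ such that for every morphism $y\to z$ the induced map $S_x(y)\to S_x(z)$ is strictly order-preserving; $S_x$ is orderable if it admits an ordering. On $\coprod_y S_x(y)$, for $f\in S_x(y)$ and $g\in S_x(z)$ define $f\le g$ if there is $h\colon y\to z$ with $g=h\circ f$; $|S_x|$ is the poset obtained by identifying $f,g$ whenever $f\le g$ and $g\le f$. A poset is noetherian if for every infinite sequence $x_1,x_2,\dots$ there exist $i<j$ with $x_i\le x_j$. $\mathcal{C}$ is Gröbner if for every object $x$, $S_x$ is orderable and $|S_x|$ is noetherian. $\mathcal{C}$ is quasi-Gröbner if there exist a Gröbner category $\mathcal{C}'$ and an essentially surjective functor $\mathcal{C}'\to\mathcal{C}$ satisfying property (F). *)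

theory Defs
  imports "HOL-Algebra.AbelCoset" "HOL-Algebra.Module"
begin

section \<open>Categories and functors\<close>

record ('o, 'm) cat =
  Obj :: "'o set"
  Arr :: "'m set"
  Dom :: "'m \<Rightarrow> 'o"
  Cod :: "'m \<Rightarrow> 'o"
  Ident :: "'o \<Rightarrow> 'm"
  Comp :: "'m \<Rightarrow> 'm \<Rightarrow> 'm"

text \<open>\<open>Comp C g f\<close> is \<open>g\<close> after \<open>f\<close>; it is meaningful only if \<open>Cod C f = Dom C g\<close>.\<close>

definition hom_set :: "('o, 'm) cat \<Rightarrow> 'o \<Rightarrow> 'o \<Rightarrow> 'm set" where
  "hom_set C x y = {f \<in> Arr C. Dom C f = x \<and> Cod C f = y}"

locale category =
  fixes C :: "('o, 'm) cat"
  assumes Dom_in: "f \<in> Arr C \<Longrightarrow> Dom C f \<in> Obj C"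
    and Cod_in: "f \<in> Arr C \<Longrightarrow> Cod C f \<in> Obj C"
    and Ident_in: "x \<in> Obj C \<Longrightarrow> Ident C x \<in> hom_set C x x"
    and Comp_in: "f \<in> hom_set C x y \<Longrightarrow> g \<in> hom_set C y z \<Longrightarrow> Comp C g f \<in> hom_set C x z"
    and Comp_Ident_right: "f \<in> hom_set C x y \<Longrightarrow> Comp C f (Ident C x) = f"
    and Comp_Ident_left: "f \<in> hom_set C x y \<Longrightarrow> Comp C (Ident C y) f = f"
    and Comp_assoc: "f \<in> hom_set C w x \<Longrightarrow> g \<in> hom_set C x y \<Longrightarrow> h \<in> hom_set C y z \<Longrightarrow>
      Comp C h (Comp C g f) = Comp C (Comp C h g) f"

definition op_cat :: "('o, 'm) cat \<Rightarrow> ('o, 'm) cat" where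
  "op_cat C = \<lparr>Obj = Obj C, Arr = Arr C, Dom = Cod C, Cod = Dom C,
     Ident = Ident C, Comp = (\<lambda>g f. Comp C f g)\<rparr>"

lemma hom_set_op_cat: "hom_set (op_cat C) x y = hom_set C y x"
  by (auto simp: hom_set_def op_cat_def)

lemma category_op_cat:
  assumes "category C" shows "category (op_cat C)"
proof -
  interpret category C by fact
  show ?thesis
    by unfold_locales (unfold hom_set_op_cat,
      auto simp: op_cat_def Dom_in Cod_in Ident_in Comp_Ident_right Comp_Ident_left Comp_assoc
        intro: Comp_in)
qed

definition isomorphic :: "('o, 'm) cat \<Rightarrow> 'o \<Rightarrow> 'o \<Rightarrow> bool" where
  "isomorphic C x y \<longleftrightarrow> (\<exists>f \<in> hom_set C x y. \<exists>g \<in> hom_set C y x.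
     Comp C g f = Ident C x \<and> Comp C f g = Ident C y)"

record ('o, 'm, 'p, 'n) func =
  on_obj :: "'o \<Rightarrow> 'p"
  on_arr :: "'m \<Rightarrow> 'n"

definition is_functor :: "('o, 'm) cat \<Rightarrow> ('p, 'n) cat \<Rightarrow> ('o, 'm, 'p, 'n) func \<Rightarrow> bool" where
  "is_functor C D \<Phi> \<longleftrightarrow>
     (\<forall>x \<in> Obj C. on_obj \<Phi> x \<in> Obj D) \<and>
     (\<forall>f \<in> Arr C. on_arr \<Phi> f \<in> hom_set D (on_obj \<Phi> (Dom C f)) (on_obj \<Phi> (Cod C f))) \<and>
     (\<forall>x \<in> Obj C. on_arr \<Phi> (Ident C x) = Ident D (on_obj \<Phi> x)) \<and>
     (\<forall>f \<in> Arr C. \<forall>g \<in> Arr C. Cod C f = Dom C g \<longrightarrow>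
        on_arr \<Phi> (Comp C g f) = Comp D (on_arr \<Phi> g) (on_arr \<Phi> f))"

definition essentially_surjective ::
    "('o, 'm) cat \<Rightarrow> ('p, 'n) cat \<Rightarrow> ('o, 'm, 'p, 'n) func \<Rightarrow> bool" where
  "essentially_surjective C D \<Phi> \<longleftrightarrow> (\<forall>y \<in> Obj D. \<exists>x \<in> Obj C. isomorphic D (on_obj \<Phi> x) y)"

definition property_F ::
    "('p, 'n) cat \<Rightarrow> ('o, 'm) cat \<Rightarrow> ('p, 'n, 'o, 'm) func \<Rightarrow> bool" where
  "property_F C' C \<Phi> \<longleftrightarrow> (\<forall>x \<in> Obj C. \<exists>(n::nat) y f.
     (\<forall>i<n. y i \<in> Obj C' \<and> f i \<in> hom_set C x (on_obj \<Phi> (y i))) \<and>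
     (\<forall>z \<in> Obj C'. \<forall>h \<in> hom_set C x (on_obj \<Phi> z).
        \<exists>i<n. \<exists>g \<in> hom_set C' (y i) z. h = Comp C (on_arr \<Phi> g) (f i)))"


section \<open>Groebner and quasi-Groebner categories\<close>

text \<open>Since an arrow determines its codomain, the disjoint union of the sets
  \<open>S\<^sub>x(y) = Hom(x, y)\<close> over all \<open>y\<close> is the set of arrows with domain \<open>x\<close>.\<close>

definition orderable_at :: "('o, 'm) cat \<Rightarrow> 'o \<Rightarrow> bool" where
  "orderable_at C x \<longleftrightarrow> (\<exists>r :: 'o \<Rightarrow> 'm rel.
     (\<forall>y \<in> Obj C. well_order_on (hom_set C x y) (r y)) \<and>
     (\<forall>y \<in> Obj C. \<forall>z \<in> Obj C. \<forall>h \<in> hom_set C y z. \<forall>f g.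
        (f, g) \<in> r y - Id \<longrightarrow> (Comp C h f, Comp C h g) \<in> r z - Id))"

definition arrows_from :: "('o, 'm) cat \<Rightarrow> 'o \<Rightarrow> 'm set" where
  "arrows_from C x = {f \<in> Arr C. Dom C f = x}"

definition factor_preorder :: "('o, 'm) cat \<Rightarrow> 'o \<Rightarrow> 'm rel" where
  "factor_preorder C x = {(f, g). f \<in> arrows_from C x \<and> g \<in> arrows_from C x \<and>
     (\<exists>h \<in> hom_set C (Cod C f) (Cod C g). g = Comp C h f)}"

definition factor_equiv :: "('o, 'm) cat \<Rightarrow> 'o \<Rightarrow> 'm rel" where
  "factor_equiv C x = factor_preorder C x \<inter> (factor_preorder C x)\<inverse>"

definition poset_carrier :: "('o, 'm) cat \<Rightarrow> 'o \<Rightarrow> 'm set set" where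
  "poset_carrier C x = arrows_from C x // factor_equiv C x"

definition poset_le :: "('o, 'm) cat \<Rightarrow> 'o \<Rightarrow> 'm set rel" where
  "poset_le C x = {(P, Q). P \<in> poset_carrier C x \<and> Q \<in> poset_carrier C x \<and>
     (\<exists>f \<in> P. \<exists>g \<in> Q. (f, g) \<in> factor_preorder C x)}"

lemma equiv_factor_equiv:
  assumes "category C" "x \<in> Obj C"
  shows "equiv (arrows_from C x) (factor_equiv C x)"
proof -
  interpret category C by fact
  have "(f, f) \<in> factor_preorder C x" if "f \<in> arrows_from C x" for f
    using that Ident_in[OF Cod_in] Comp_Ident_left
    by (fastforce simp: factor_preorder_def arrows_from_def hom_set_def)
  moreover have "trans (factor_preorder C x)"
  proof (rule transI)
    fix f g h
    assume "(f, g) \<in> factor_preorder C x" "(g, h) \<in> factor_preorder C x"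
    then obtain u v where *: "f \<in> arrows_from C x" "h \<in> arrows_from C x"
        "u \<in> hom_set C (Cod C f) (Cod C g)" "g = Comp C u f"
        "v \<in> hom_set C (Cod C g) (Cod C h)" "h = Comp C v g"
      by (auto simp: factor_preorder_def)
    then have "h = Comp C (Comp C v u) f"
      using Comp_assoc[of f x "Cod C f" u _ v] by (simp add: arrows_from_def hom_set_def)
    then show "(f, h) \<in> factor_preorder C x"
      using * Comp_in[of u _ _ v] by (auto simp: factor_preorder_def)
  qed
  ultimately show ?thesis
    unfolding equiv_def factor_equiv_def
    by (auto intro!: refl_onI symI transI dest: transD simp: factor_preorder_def)
qed

definition noetherian_poset :: "'a set \<Rightarrow> 'a rel \<Rightarrow> bool" where
  "noetherian_poset A r \<longleftrightarrow>
     (\<forall>s :: nat \<Rightarrow> 'a. (\<forall>i. s i \<in> A) \<longrightarrow> (\<exists>i j. i < j \<and> (s i, s j) \<in> r))"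

definition groebner :: "('o, 'm) cat \<Rightarrow> bool" where
  "groebner C \<longleftrightarrow> category C \<and>
     (\<forall>x \<in> Obj C. orderable_at C x \<and> noetherian_poset (poset_carrier C x) (poset_le C x))"

text \<open>HOL cannot quantify existentially over types, so the types in which the objects and the
  arrows of the Groebner category live are parameters.\<close>

definition quasi_groebner :: "'p itself \<Rightarrow> 'n itself \<Rightarrow> ('o, 'm) cat \<Rightarrow> bool" where
  "quasi_groebner (_ :: 'p itself) (_ :: 'n itself) C \<longleftrightarrow> category C \<and>
     (\<exists>(C' :: ('p, 'n) cat) \<Phi>. groebner C' \<and> is_functor C' C \<Phi> \<and>
        essentially_surjective C' C \<Phi> \<and> property_F C' C \<Phi>)"


section \<open>Left modules and left-noetherian rings\<close>

text \<open>The locale \<open>module\<close> of the library requires a commutative ring. Its record type is reused;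
  the multiplicative fields of a module are irrelevant.\<close>

locale left_module = R?: ring R + M?: abelian_group M
    for R :: "('k, 'z) ring_scheme" (structure) and M :: "('k, 'v, 'w) module_scheme" (structure) +
  assumes lsmult_closed: "\<lbrakk>a \<in> carrier R; x \<in> carrier M\<rbrakk> \<Longrightarrow> a \<odot>\<^bsub>M\<^esub> x \<in> carrier M"
    and lsmult_l_distr: "\<lbrakk>a \<in> carrier R; b \<in> carrier R; x \<in> carrier M\<rbrakk> \<Longrightarrow>
      (a \<oplus> b) \<odot>\<^bsub>M\<^esub> x = a \<odot>\<^bsub>M\<^esub> x \<oplus>\<^bsub>M\<^esub> b \<odot>\<^bsub>M\<^esub> x"
    and lsmult_r_distr: "\<lbrakk>a \<in> carrier R; x \<in> carrier M; y \<in> carrier M\<rbrakk> \<Longrightarrow>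
      a \<odot>\<^bsub>M\<^esub> (x \<oplus>\<^bsub>M\<^esub> y) = a \<odot>\<^bsub>M\<^esub> x \<oplus>\<^bsub>M\<^esub> a \<odot>\<^bsub>M\<^esub> y"
    and lsmult_assoc: "\<lbrakk>a \<in> carrier R; b \<in> carrier R; x \<in> carrier M\<rbrakk> \<Longrightarrow>
      (a \<otimes> b) \<odot>\<^bsub>M\<^esub> x = a \<odot>\<^bsub>M\<^esub> (b \<odot>\<^bsub>M\<^esub> x)"
    and lsmult_one: "x \<in> carrier M \<Longrightarrow> \<one> \<odot>\<^bsub>M\<^esub> x = x"

definition left_module_hom ::
    "('k, 'z) ring_scheme \<Rightarrow> ('k, 'v) module \<Rightarrow> ('k, 'w) module \<Rightarrow> ('v \<Rightarrow> 'w) set" where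
  "left_module_hom R M N = {f \<in> carrier M \<rightarrow> carrier N.
     (\<forall>x \<in> carrier M. \<forall>y \<in> carrier M. f (x \<oplus>\<^bsub>M\<^esub> y) = f x \<oplus>\<^bsub>N\<^esub> f y) \<and>
     (\<forall>a \<in> carrier R. \<forall>x \<in> carrier M. f (a \<odot>\<^bsub>M\<^esub> x) = a \<odot>\<^bsub>N\<^esub> f x)}"

definition left_ideal :: "('k, 'z) ring_scheme \<Rightarrow> 'k set \<Rightarrow> bool" where
  "left_ideal R I \<longleftrightarrow> additive_subgroup I R \<and>
     (\<forall>a \<in> carrier R. \<forall>x \<in> I. a \<otimes>\<^bsub>R\<^esub> x \<in> I)"

definition left_noetherian :: "('k, 'z) ring_scheme \<Rightarrow> bool" where
  "left_noetherian R \<longleftrightarrow> ring R \<and>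
     (\<forall>I :: nat \<Rightarrow> 'k set. (\<forall>n. left_ideal R (I n)) \<and> (\<forall>n. I n \<subseteq> I (Suc n)) \<longrightarrow>
        (\<exists>n. \<forall>m\<ge>n. I m = I n))"


section \<open>Representations of categories\<close>

record ('o, 'm, 'k, 'v) rep =
  rep_obj :: "'o \<Rightarrow> ('k, 'v) module"
  rep_map :: "'m \<Rightarrow> 'v \<Rightarrow> 'v"

definition representation ::
    "('k, 'z) ring_scheme \<Rightarrow> ('o, 'm) cat \<Rightarrow> ('o, 'm, 'k, 'v) rep \<Rightarrow> bool" where
  "representation R C F \<longleftrightarrow>
     (\<forall>x \<in> Obj C. left_module R (rep_obj F x)) \<and>
     (\<forall>f \<in> Arr C. rep_map F f \<in> left_module_hom R (rep_obj F (Dom C f)) (rep_obj F (Cod C f))) \<and>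
     (\<forall>x \<in> Obj C. \<forall>v \<in> carrier (rep_obj F x). rep_map F (Ident C x) v = v) \<and>
     (\<forall>f \<in> Arr C. \<forall>g \<in> Arr C. Cod C f = Dom C g \<longrightarrow>
        (\<forall>v \<in> carrier (rep_obj F (Dom C f)).
           rep_map F (Comp C g f) v = rep_map F g (rep_map F f v)))"

definition nat_trans :: "('k, 'z) ring_scheme \<Rightarrow> ('o, 'm) cat \<Rightarrow>
    ('o, 'm, 'k, 'v) rep \<Rightarrow> ('o, 'm, 'k, 'w) rep \<Rightarrow> ('o \<Rightarrow> 'v \<Rightarrow> 'w) \<Rightarrow> bool" where
  "nat_trans R C F F' \<eta> \<longleftrightarrow>
     (\<forall>x \<in> Obj C. \<eta> x \<in> left_module_hom R (rep_obj F x) (rep_obj F' x)) \<and>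
     (\<forall>f \<in> Arr C. \<forall>v \<in> carrier (rep_obj F (Dom C f)).
        \<eta> (Cod C f) (rep_map F f v) = rep_map F' f (\<eta> (Dom C f) v))"

definition is_quotient :: "('k, 'z) ring_scheme \<Rightarrow> ('o, 'm) cat \<Rightarrow>
    ('o, 'm, 'k, 'v) rep \<Rightarrow> ('o, 'm, 'k, 'w) rep \<Rightarrow> bool" where
  "is_quotient R C F F' \<longleftrightarrow> (\<exists>\<eta>. nat_trans R C F F' \<eta> \<and>
     (\<forall>x \<in> Obj C. \<eta> x ` carrier (rep_obj F x) = carrier (rep_obj F' x)))"

text \<open>The free left module on a set \<open>B\<close> consists of the finitely supported functions on \<open>B\<close>,
  extended by zero outside \<open>B\<close>.\<close>

definition free_left_module :: "('k, 'z) ring_scheme \<Rightarrow> 'b set \<Rightarrow> ('k, 'b \<Rightarrow> 'k) module" where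
  "free_left_module R B =
     \<lparr>carrier = {a. (\<forall>b. a b \<in> carrier R) \<and> (\<forall>b. b \<notin> B \<longrightarrow> a b = \<zero>\<^bsub>R\<^esub>) \<and>
        finite {b. a b \<noteq> \<zero>\<^bsub>R\<^esub>}},
      mult = undefined, one = undefined,
      zero = (\<lambda>b. \<zero>\<^bsub>R\<^esub>), add = (\<lambda>a a' b. a b \<oplus>\<^bsub>R\<^esub> a' b),
      smult = (\<lambda>c a b. c \<otimes>\<^bsub>R\<^esub> a b)\<rparr>"

text \<open>The arrow \<open>h\<close> sends the basis element \<open>f\<close> to the basis element \<open>Comp C h f\<close>, hence the
  coefficient of the image at \<open>g\<close> is the sum of the coefficients at all \<open>f\<close> with
  \<open>Comp C h f = g\<close>.\<close>

definition principal_projective ::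
    "('k, 'z) ring_scheme \<Rightarrow> ('o, 'm) cat \<Rightarrow> 'o \<Rightarrow> ('o, 'm, 'k, 'm \<Rightarrow> 'k) rep" where
  "principal_projective R C x =
     \<lparr>rep_obj = (\<lambda>y. free_left_module R (hom_set C x y)),
      rep_map = (\<lambda>h a g.
        \<Oplus>\<^bsub>R\<^esub>f \<in> {f \<in> hom_set C x (Dom C h). a f \<noteq> \<zero>\<^bsub>R\<^esub> \<and> Comp C h f = g}. a f)\<rparr>"

definition direct_sum_module :: "nat \<Rightarrow> (nat \<Rightarrow> ('k, 'v) module) \<Rightarrow> ('k, nat \<Rightarrow> 'v) module" where
  "direct_sum_module n M =
     \<lparr>carrier = (\<Pi>\<^sub>E i \<in> {..<n}. carrier (M i)),
      mult = undefined, one = undefined,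
      zero = (\<lambda>i \<in> {..<n}. \<zero>\<^bsub>M i\<^esub>),
      add = (\<lambda>u v. \<lambda>i \<in> {..<n}. u i \<oplus>\<^bsub>M i\<^esub> v i),
      smult = (\<lambda>c u. \<lambda>i \<in> {..<n}. c \<odot>\<^bsub>M i\<^esub> u i)\<rparr>"

definition direct_sum_rep ::
    "nat \<Rightarrow> (nat \<Rightarrow> ('o, 'm, 'k, 'v) rep) \<Rightarrow> ('o, 'm, 'k, nat \<Rightarrow> 'v) rep" where
  "direct_sum_rep n F =
     \<lparr>rep_obj = (\<lambda>y. direct_sum_module n (\<lambda>i. rep_obj (F i) y)),
      rep_map = (\<lambda>h u. \<lambda>i \<in> {..<n}. rep_map (F i) h (u i))\<rparr>"

definition fin_gen_rep ::
    "('k, 'z) ring_scheme \<Rightarrow> ('o, 'm) cat \<Rightarrow> ('o, 'm, 'k, 'v) rep \<Rightarrow> bool" where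
  "fin_gen_rep R C F \<longleftrightarrow> representation R C F \<and>
     (\<exists>n x. (\<forall>i<n. x i \<in> Obj C) \<and>
        is_quotient R C (direct_sum_rep n (\<lambda>i. principal_projective R C (x i))) F)"

definition subrep :: "('k, 'z) ring_scheme \<Rightarrow> ('o, 'm) cat \<Rightarrow>
    ('o, 'm, 'k, 'v) rep \<Rightarrow> ('o \<Rightarrow> 'v set) \<Rightarrow> bool" where
  "subrep R C F N \<longleftrightarrow>
     (\<forall>x \<in> Obj C. submodule (N x) R (rep_obj F x)) \<and>
     (\<forall>f \<in> Arr C. rep_map F f ` N (Dom C f) \<subseteq> N (Cod C f))"

definition noetherian_rep ::
    "('k, 'z) ring_scheme \<Rightarrow> ('o, 'm) cat \<Rightarrow> ('o, 'm, 'k, 'v) rep \<Rightarrow> bool" where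
  "noetherian_rep R C F \<longleftrightarrow> representation R C F \<and>
     (\<forall>N :: nat \<Rightarrow> 'o \<Rightarrow> 'v set.
        (\<forall>n. subrep R C F (N n)) \<and> (\<forall>n. \<forall>x \<in> Obj C. N n x \<subseteq> N (Suc n) x) \<longrightarrow>
        (\<exists>n. \<forall>m\<ge>n. \<forall>x \<in> Obj C. N m x = N n x))"

text \<open>The type parameter is the type in which the underlying sets of the modules live. Keeping it
  as a type variable amounts to quantifying over all representations.\<close>

definition noetherian_Rep ::
    "'v itself \<Rightarrow> ('k, 'z) ring_scheme \<Rightarrow> ('o, 'm) cat \<Rightarrow> bool" where
  "noetherian_Rep (_ :: 'v itself) R C \<longleftrightarrow>
     (\<forall>F :: ('o, 'm, 'k, 'v) rep. fin_gen_rep R C F \<longrightarrow> noetherian_rep R C F)"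


section \<open>The category of finite sets and surjective G-maps\<close>

text \<open>The objects are the finite subsets of the type \<open>'a\<close>. If \<open>'a\<close> is infinite, every finite set
  is in bijection with one of them. The functions of a G-map are made extensional, so that
  equality of arrows is equality of G-maps.\<close>

datatype ('a, 'g) gmap =
  GMap (gdom: "'a set") (gcod: "'a set") (gfun: "'a \<Rightarrow> 'a") (gweight: "'a \<Rightarrow> 'g")

definition FS :: "('g, 'e) monoid_scheme \<Rightarrow> ('a set, ('a, 'g) gmap) cat" where
  "FS G =
     \<lparr>Obj = {R. finite R},
      Arr = {GMap R S f \<rho> | R S f \<rho>. finite R \<and> finite S \<and>
        f \<in> R \<rightarrow>\<^sub>E S \<and> f ` R = S \<and> \<rho> \<in> R \<rightarrow>\<^sub>E carrier G},
      Dom = gdom, Cod = gcod,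
      Ident = (\<lambda>R. GMap R R (\<lambda>x \<in> R. x) (\<lambda>x \<in> R. \<one>\<^bsub>G\<^esub>)),
      Comp = (\<lambda>b a. GMap (gdom a) (gcod b) (\<lambda>x \<in> gdom a. gfun b (gfun a x))
        (\<lambda>x \<in> gdom a. gweight b (gfun a x) \<otimes>\<^bsub>G\<^esub> gweight a x))\<rparr>"

lemma hom_set_FS:
  "hom_set (FS G) R S = {GMap R S f \<rho> | f \<rho>. finite R \<and> finite S \<and>
     f \<in> R \<rightarrow>\<^sub>E S \<and> f ` R = S \<and> \<rho> \<in> R \<rightarrow>\<^sub>E carrier G}"
  by (auto simp: hom_set_def FS_def)

lemma category_FS:
  assumes "group G" shows "category (FS G :: ('a set, ('a, 'g) gmap) cat)"
proof -
  interpret group G by fact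
  show ?thesis
  proof
    fix f :: "('a, 'g) gmap"
    assume "f \<in> Arr (FS G)"
    then show "Dom (FS G) f \<in> Obj (FS G)" "Cod (FS G) f \<in> Obj (FS G)"
      by (auto simp: FS_def)
  next
    fix R :: "'a set"
    assume "R \<in> Obj (FS G)"
    then show "Ident (FS G) R \<in> hom_set (FS G) R R"
      unfolding hom_set_FS by (auto simp: FS_def)
  next
    fix f g :: "('a, 'g) gmap" and x y z
    assume "f \<in> hom_set (FS G) x y" "g \<in> hom_set (FS G) y z"
    then show "Comp (FS G) g f \<in> hom_set (FS G) x z"
      unfolding hom_set_FS by (auto simp: FS_def PiE_iff image_iff)
  next
    fix f :: "('a, 'g) gmap" and x y
    assume "f \<in> hom_set (FS G) x y"
    then show "Comp (FS G) f (Ident (FS G) x) = f" "Comp (FS G) (Ident (FS G) y) f = f"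
      unfolding hom_set_FS by (auto simp: FS_def PiE_iff extensional_def fun_eq_iff)
  next
    fix f g h :: "('a, 'g) gmap" and w x y z
    assume "f \<in> hom_set (FS G) w x" "g \<in> hom_set (FS G) x y" "h \<in> hom_set (FS G) y z"
    then show "Comp (FS G) h (Comp (FS G) g f) = Comp (FS G) (Comp (FS G) h g) f"
      unfolding hom_set_FS by (auto simp: FS_def PiE_iff extensional_def fun_eq_iff m_assoc)
  qed
qed



section \<open>Well-definedness of direct sums and principal projectives\<close>

lemma left_module_free_left_module:
  assumes "ring R" shows "left_module R (free_left_module R B)"
proof -
  interpret ring R by fact
  let ?M = "free_left_module R B"
  have mem: "u \<in> carrier ?M \<longleftrightarrow> (\<forall>b. u b \<in> carrier R) \<and> (\<forall>b. b \<notin> B \<longrightarrow> u b = \<zero>\<^bsub>R\<^esub>) \<and>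
      finite {b. u b \<noteq> \<zero>\<^bsub>R\<^esub>}" for u
    by (simp add: free_left_module_def)
  have ops: "u \<oplus>\<^bsub>?M\<^esub> v = (\<lambda>b. u b \<oplus>\<^bsub>R\<^esub> v b)" "\<zero>\<^bsub>?M\<^esub> = (\<lambda>b. \<zero>\<^bsub>R\<^esub>)"
     "c \<odot>\<^bsub>?M\<^esub> u = (\<lambda>b. c \<otimes>\<^bsub>R\<^esub> u b)" for u v c
    by (simp_all add: free_left_module_def)
  have add: "u \<oplus>\<^bsub>?M\<^esub> v \<in> carrier ?M" if "u \<in> carrier ?M" "v \<in> carrier ?M" for u v
  proof -
    have "finite ({b. u b \<noteq> \<zero>\<^bsub>R\<^esub>} \<union> {b. v b \<noteq> \<zero>\<^bsub>R\<^esub>})" using that by (simp add: mem)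
    then have "finite {b. u b \<oplus>\<^bsub>R\<^esub> v b \<noteq> \<zero>\<^bsub>R\<^esub>}" by (rule rev_finite_subset) auto
    then show ?thesis using that by (simp add: mem ops)
  qed
  have smult: "c \<odot>\<^bsub>?M\<^esub> u \<in> carrier ?M" if "c \<in> carrier R" "u \<in> carrier ?M" for u c
  proof -
    have "finite {b. u b \<noteq> \<zero>\<^bsub>R\<^esub>}" using that by (simp add: mem)
    then have "finite {b. c \<otimes>\<^bsub>R\<^esub> u b \<noteq> \<zero>\<^bsub>R\<^esub>}" by (rule rev_finite_subset) (use that in auto)
    then show ?thesis using that by (simp add: mem ops)
  qed
  have "abelian_group ?M"
  proof (rule abelian_groupI)
    fix u assume u: "u \<in> carrier ?M"
    have "\<ominus>\<^bsub>R\<^esub> u b = \<ominus>\<^bsub>R\<^esub> \<one>\<^bsub>R\<^esub> \<otimes>\<^bsub>R\<^esub> u b" for b using u by (simp add: mem l_minus)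
    then have "(\<lambda>b. \<ominus>\<^bsub>R\<^esub> u b) \<in> carrier ?M"
      using smult[OF _ u, of "\<ominus>\<^bsub>R\<^esub> \<one>\<^bsub>R\<^esub>"] by (simp add: ops)
    moreover have "(\<lambda>b. \<ominus>\<^bsub>R\<^esub> u b) \<oplus>\<^bsub>?M\<^esub> u = \<zero>\<^bsub>?M\<^esub>"
      using u by (simp add: ops mem l_neg)
    ultimately show "\<exists>v \<in> carrier ?M. v \<oplus>\<^bsub>?M\<^esub> u = \<zero>\<^bsub>?M\<^esub>" by blast
  qed (simp add: add; fail | simp add: ops mem a_assoc; fail | simp add: ops mem, rule ext, simp add: a_comm)+
  then interpret M: abelian_group ?M .
  show ?thesis
    by unfold_locales
      (simp add: smult; fail | simp add: ops mem l_distr r_distr m_assoc; fail)+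
qed

lemma left_module_direct_sum_module:
  assumes R: "ring R" and M: "\<And>i. i < n \<Longrightarrow> left_module R (M i)"
  shows "left_module R (direct_sum_module n M)"
proof -
  interpret ring R by fact
  let ?D = "direct_sum_module n M"
  note M_simps = left_module.lsmult_closed left_module.lsmult_l_distr
    left_module.lsmult_r_distr left_module.lsmult_assoc left_module.lsmult_one
  note G_simps = abelian_monoid.a_closed abelian_monoid.zero_closed abelian_monoid.l_zero
    abelian_monoid.a_assoc
  have G: "abelian_group (M i)" if "i < n" for i
    using M[OF that] by (simp add: left_module_def)
  then have G': "abelian_monoid (M i)" if "i < n" for i
    using that by (simp add: abelian_group_def)
  have "abelian_group ?D"
  proof (rule abelian_groupI)
    fix u assume u: "u \<in> carrier ?D"
    let ?v = "\<lambda>i\<in>{..<n}. \<ominus>\<^bsub>M i\<^esub> u i"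
    have "?v \<in> carrier ?D"
      using u by (auto simp: direct_sum_module_def intro!: abelian_group.a_inv_closed G)
    moreover have "?v \<oplus>\<^bsub>?D\<^esub> u = \<zero>\<^bsub>?D\<^esub>"
      using u by (auto simp: direct_sum_module_def fun_eq_iff intro!: abelian_group.l_neg G)
    ultimately show "\<exists>v \<in> carrier ?D. v \<oplus>\<^bsub>?D\<^esub> u = \<zero>\<^bsub>?D\<^esub>" by blast
  qed (auto simp: direct_sum_module_def fun_eq_iff PiE_iff extensional_def G_simps G'
        intro: abelian_monoid.a_comm[OF G'])
  then interpret D: abelian_group ?D .
  show ?thesis
    by unfold_locales
      (auto simp: direct_sum_module_def fun_eq_iff PiE_iff extensional_def M_simps[OF M] G_simps[OF G'])
qed

lemma rep_map_principal_projective: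
  fixes R :: "('k, 'z) ring_scheme" and C :: "('o, 'm) cat"
  assumes R: "ring R" and C: "category C" and h: "h \<in> hom_set C y z"
    and a: "a \<in> carrier (free_left_module R (hom_set C x y))"
    and A: "finite A" "{f. a f \<noteq> \<zero>\<^bsub>R\<^esub>} \<subseteq> A"
  shows "rep_map (principal_projective R C x) h a g =
    (\<Oplus>\<^bsub>R\<^esub>f \<in> A. if Comp C h f = g then a f else \<zero>\<^bsub>R\<^esub>)"
proof -
  interpret ring R by fact
  let ?B = "{f \<in> hom_set C x (Dom C h). a f \<noteq> \<zero>\<^bsub>R\<^esub> \<and> Comp C h f = g}"
  have y: "Dom C h = y" using h by (simp add: hom_set_def)
  have car: "a f \<in> carrier R" for f using a by (simp add: free_left_module_def)
  have "rep_map (principal_projective R C x) h a g = (\<Oplus>\<^bsub>R\<^esub>f \<in> ?B. a f)"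
    by (simp add: principal_projective_def)
  also have "\<dots> = (\<Oplus>\<^bsub>R\<^esub>f \<in> ?B. if Comp C h f = g then a f else \<zero>\<^bsub>R\<^esub>)"
    by (rule finsum_cong') (auto simp: car)
  also have "\<dots> = (\<Oplus>\<^bsub>R\<^esub>f \<in> A. if Comp C h f = g then a f else \<zero>\<^bsub>R\<^esub>)"
    using A a by (intro add.finprod_mono_neutral_cong_left)
      (auto simp: car y free_left_module_def)
  finally show ?thesis .
qed

lemma representation_principal_projective:
  fixes R :: "('k, 'z) ring_scheme" and C :: "('o, 'm) cat"
  assumes R: "ring R" and C: "category C" and x: "x \<in> Obj C"
  shows "representation R C (principal_projective R C x)"
proof -
  interpret ring R by fact
  interpret category C by fact
  let ?P = "principal_projective R C x"
  note rm = rep_map_principal_projective[OF R C]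
  have obj: "rep_obj ?P y = free_left_module R (hom_set C x y)" for y
    by (simp add: principal_projective_def)
  have car: "a f \<in> carrier R" if "a \<in> carrier (free_left_module R B)" for a f and B :: "'m set"
    using that by (simp add: free_left_module_def)
  have fin: "finite {f. a f \<noteq> \<zero>\<^bsub>R\<^esub>}" if "a \<in> carrier (free_left_module R B)" for a and B :: "'m set"
    using that by (simp add: free_left_module_def)
  have supp: "f \<in> B" if "a \<in> carrier (free_left_module R B)" "a f \<noteq> \<zero>\<^bsub>R\<^esub>" for a f and B :: "'m set"
    using that by (auto simp: free_left_module_def)
  have nz: "\<exists>f. a f \<noteq> \<zero>\<^bsub>R\<^esub> \<and> Comp C h f = g"
    if h: "h \<in> hom_set C y z" and a: "a \<in> carrier (free_left_module R (hom_set C x y))"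
      and n: "rep_map ?P h a g \<noteq> \<zero>\<^bsub>R\<^esub>" for h a g y z
  proof (rule ccontr)
    assume "\<not> ?thesis"
    then have "rep_map ?P h a g = (\<Oplus>\<^bsub>R\<^esub>f \<in> {f. a f \<noteq> \<zero>\<^bsub>R\<^esub>}. \<zero>\<^bsub>R\<^esub>)"
      unfolding rm[OF h a fin[OF a] order_refl] by (intro finsum_cong') auto
    then show False using n by simp
  qed
  have closed: "rep_map ?P h a \<in> carrier (free_left_module R (hom_set C x z))"
    if h: "h \<in> hom_set C y z" and a: "a \<in> carrier (free_left_module R (hom_set C x y))" for h a y z
  proof -
    have "rep_map ?P h a g \<in> carrier R" for g
      unfolding rm[OF h a fin[OF a] order_refl] by (intro finsum_closed) (auto simp: car[OF a])
    moreover have "g \<in> hom_set C x z" if "rep_map ?P h a g \<noteq> \<zero>\<^bsub>R\<^esub>" for g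
      using nz[OF h a that] supp[OF a] Comp_in h by blast
    moreover have "finite {g. rep_map ?P h a g \<noteq> \<zero>\<^bsub>R\<^esub>}"
      by (rule finite_subset[OF _ finite_imageI[OF fin[OF a], of "Comp C h"]])
        (use nz[OF h a] in blast)
    ultimately show ?thesis by (auto simp: free_left_module_def)
  qed
  have add: "rep_map ?P h (a \<oplus>\<^bsub>free_left_module R (hom_set C x y)\<^esub> b) g =
      rep_map ?P h a g \<oplus>\<^bsub>R\<^esub> rep_map ?P h b g"
    if h: "h \<in> hom_set C y z" and a: "a \<in> carrier (free_left_module R (hom_set C x y))"
      and b: "b \<in> carrier (free_left_module R (hom_set C x y))" for h a b g y z
  proof -
    let ?M = "free_left_module R (hom_set C x y)"
    let ?A = "{f. a f \<noteq> \<zero>\<^bsub>R\<^esub>} \<union> {f. b f \<noteq> \<zero>\<^bsub>R\<^esub>}"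
    interpret M: left_module R ?M by (rule left_module_free_left_module[OF R])
    have ab: "a \<oplus>\<^bsub>?M\<^esub> b \<in> carrier ?M" using a b by simp
    have A: "finite ?A" using fin[OF a] fin[OF b] by simp
    have s: "(a \<oplus>\<^bsub>?M\<^esub> b) f = a f \<oplus>\<^bsub>R\<^esub> b f" for f by (simp add: free_left_module_def)
    have 1: "rep_map ?P h (a \<oplus>\<^bsub>?M\<^esub> b) g =
        (\<Oplus>\<^bsub>R\<^esub>f \<in> ?A. if Comp C h f = g then (a \<oplus>\<^bsub>?M\<^esub> b) f else \<zero>\<^bsub>R\<^esub>)"
      by (rule rm[OF h ab A]) (auto simp: s)
    have 2: "rep_map ?P h a g = (\<Oplus>\<^bsub>R\<^esub>f \<in> ?A. if Comp C h f = g then a f else \<zero>\<^bsub>R\<^esub>)"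
      by (rule rm[OF h a A]) auto
    have 3: "rep_map ?P h b g = (\<Oplus>\<^bsub>R\<^esub>f \<in> ?A. if Comp C h f = g then b f else \<zero>\<^bsub>R\<^esub>)"
      by (rule rm[OF h b A]) auto
    show ?thesis unfolding 1 2 3
      by (rule trans[OF finsum_cong' finsum_addf]) (auto simp: car[OF a] car[OF b] s)
  qed
  have smult: "rep_map ?P h (c \<odot>\<^bsub>free_left_module R (hom_set C x y)\<^esub> a) g =
      c \<otimes>\<^bsub>R\<^esub> rep_map ?P h a g"
    if h: "h \<in> hom_set C y z" and a: "a \<in> carrier (free_left_module R (hom_set C x y))"
      and c: "c \<in> carrier R" for h a c g y z
  proof -
    let ?M = "free_left_module R (hom_set C x y)"
    interpret M: left_module R ?M by (rule left_module_free_left_module[OF R])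
    have ca: "c \<odot>\<^bsub>?M\<^esub> a \<in> carrier ?M" using a c by (rule M.lsmult_closed[rotated])
    have s: "(c \<odot>\<^bsub>?M\<^esub> a) f = c \<otimes>\<^bsub>R\<^esub> a f" for f by (simp add: free_left_module_def)
    have 1: "rep_map ?P h (c \<odot>\<^bsub>?M\<^esub> a) g = (\<Oplus>\<^bsub>R\<^esub>f \<in> {f. a f \<noteq> \<zero>\<^bsub>R\<^esub>}.
        if Comp C h f = g then (c \<odot>\<^bsub>?M\<^esub> a) f else \<zero>\<^bsub>R\<^esub>)"
      by (rule rm[OF h ca fin[OF a]]) (use c in \<open>auto simp: s\<close>)
    show ?thesis unfolding 1 rm[OF h a fin[OF a] order_refl]
      by (subst finsum_rdistr[OF fin[OF a] c], (auto simp: car[OF a])[1], rule finsum_cong')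
        (auto simp: car[OF a] s c)
  qed
  have hom: "rep_map ?P h \<in> left_module_hom R (rep_obj ?P (Dom C h)) (rep_obj ?P (Cod C h))"
    if "h \<in> Arr C" for h
  proof -
    have h: "h \<in> hom_set C (Dom C h) (Cod C h)" using that by (simp add: hom_set_def)
    show ?thesis
      unfolding left_module_hom_def obj mem_Collect_eq
    proof (intro conjI ballI funcsetI)
      fix a b
      assume a: "a \<in> carrier (free_left_module R (hom_set C x (Dom C h)))"
      then show "rep_map ?P h a \<in> carrier (free_left_module R (hom_set C x (Cod C h)))"
        by (rule closed[OF h])
      assume b: "b \<in> carrier (free_left_module R (hom_set C x (Dom C h)))"
      show "rep_map ?P h (a \<oplus>\<^bsub>free_left_module R (hom_set C x (Dom C h))\<^esub> b) =
          rep_map ?P h a \<oplus>\<^bsub>free_left_module R (hom_set C x (Cod C h))\<^esub> rep_map ?P h b"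
        by (rule ext, subst add[OF h a b]) (simp add: free_left_module_def)
    next
      fix c a
      assume c: "c \<in> carrier R" and a: "a \<in> carrier (free_left_module R (hom_set C x (Dom C h)))"
      show "rep_map ?P h (c \<odot>\<^bsub>free_left_module R (hom_set C x (Dom C h))\<^esub> a) =
          c \<odot>\<^bsub>free_left_module R (hom_set C x (Cod C h))\<^esub> rep_map ?P h a"
        by (rule ext, subst smult[OF h a c]) (simp add: free_left_module_def)
    qed
  qed
  have ident: "rep_map ?P (Ident C y) a = a"
    if y: "y \<in> Obj C" and a: "a \<in> carrier (free_left_module R (hom_set C x y))" for y a
  proof
    fix g
    let ?A = "insert g {f. a f \<noteq> \<zero>\<^bsub>R\<^esub>}"
    have "rep_map ?P (Ident C y) a g =
        (\<Oplus>\<^bsub>R\<^esub>f \<in> ?A. if Comp C (Ident C y) f = g then a f else \<zero>\<^bsub>R\<^esub>)"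
      by (rule rm[OF Ident_in[OF y] a]) (use fin[OF a] in auto)
    also have "\<dots> = (\<Oplus>\<^bsub>R\<^esub>f \<in> ?A. if g = f then a f else \<zero>\<^bsub>R\<^esub>)"
    proof (rule finsum_cong')
      fix f assume "f \<in> ?A"
      show "(if Comp C (Ident C y) f = g then a f else \<zero>\<^bsub>R\<^esub>) = (if g = f then a f else \<zero>\<^bsub>R\<^esub>)"
        using supp[OF a, of f] Comp_Ident_left[of f x y] by (cases "a f = \<zero>\<^bsub>R\<^esub>") auto
    qed (auto simp: car[OF a])
    also have "\<dots> = a g"
      using fin[OF a] by (intro add.finprod_singleton) (auto simp: car[OF a])
    finally show "rep_map ?P (Ident C y) a g = a g" .
  qed
  have swap: "(\<Oplus>\<^bsub>R\<^esub>v \<in> B. \<Oplus>\<^bsub>R\<^esub>u \<in> A. t u v) = (\<Oplus>\<^bsub>R\<^esub>u \<in> A. \<Oplus>\<^bsub>R\<^esub>v \<in> B. t u v)"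
    if "finite B" "finite A" "\<And>u v. t u v \<in> carrier R" for A B :: "'m set" and t
    using that(1)
  proof (induction B rule: finite_induct)
    case (insert v B)
    have "(\<Oplus>\<^bsub>R\<^esub>u \<in> A. \<Oplus>\<^bsub>R\<^esub>v \<in> insert v B. t u v) = (\<Oplus>\<^bsub>R\<^esub>u \<in> A. t u v \<oplus>\<^bsub>R\<^esub> (\<Oplus>\<^bsub>R\<^esub>v \<in> B. t u v))"
      by (rule finsum_cong') (use insert that in auto)
    also have "\<dots> = (\<Oplus>\<^bsub>R\<^esub>u \<in> A. t u v) \<oplus>\<^bsub>R\<^esub> (\<Oplus>\<^bsub>R\<^esub>u \<in> A. \<Oplus>\<^bsub>R\<^esub>v \<in> B. t u v)"
      by (rule finsum_addf) (use that in auto)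
    finally show ?case using insert that by simp
  qed (use that in simp)
  have comp: "rep_map ?P (Comp C h f) a = rep_map ?P h (rep_map ?P f a)"
    if f: "f \<in> Arr C" and h: "h \<in> Arr C" and fh: "Cod C f = Dom C h"
      and a: "a \<in> carrier (free_left_module R (hom_set C x (Dom C f)))" for f h a
  proof
    fix g
    have f': "f \<in> hom_set C (Dom C f) (Dom C h)" and h': "h \<in> hom_set C (Dom C h) (Cod C h)"
      using f h fh by (auto simp: hom_set_def)
    let ?A = "{u. a u \<noteq> \<zero>\<^bsub>R\<^esub>}" and ?b = "rep_map ?P f a"
    let ?B = "Comp C f ` ?A"
    have A: "finite ?A" "finite ?B" using fin[OF a] by auto
    have sub: "{v. ?b v \<noteq> \<zero>\<^bsub>R\<^esub>} \<subseteq> ?B" using nz[OF f' a] by blast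
    have "rep_map ?P h ?b g = (\<Oplus>\<^bsub>R\<^esub>v \<in> ?B. if Comp C h v = g then ?b v else \<zero>\<^bsub>R\<^esub>)"
      by (rule rm[OF h' closed[OF f' a] A(2) sub])
    also have "\<dots> = (\<Oplus>\<^bsub>R\<^esub>v \<in> ?B. \<Oplus>\<^bsub>R\<^esub>u \<in> ?A.
        if Comp C f u = v then (if Comp C h v = g then a u else \<zero>\<^bsub>R\<^esub>) else \<zero>\<^bsub>R\<^esub>)"
      unfolding rm[OF f' a A(1) order_refl]
    proof (rule finsum_cong')
      fix v
      show "(if Comp C h v = g then \<Oplus>\<^bsub>R\<^esub>u \<in> ?A. if Comp C f u = v then a u else \<zero>\<^bsub>R\<^esub> else \<zero>\<^bsub>R\<^esub>) =
        (\<Oplus>\<^bsub>R\<^esub>u \<in> ?A. if Comp C f u = v then (if Comp C h v = g then a u else \<zero>\<^bsub>R\<^esub>) else \<zero>\<^bsub>R\<^esub>)"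
        by (cases "Comp C h v = g") (simp_all add: cong: if_cong)
    qed (auto simp: car[OF a])
    also have "\<dots> = (\<Oplus>\<^bsub>R\<^esub>u \<in> ?A. \<Oplus>\<^bsub>R\<^esub>v \<in> ?B.
        if Comp C f u = v then (if Comp C h v = g then a u else \<zero>\<^bsub>R\<^esub>) else \<zero>\<^bsub>R\<^esub>)"
      by (rule swap[OF A(2,1)]) (auto simp: car[OF a])
    also have "\<dots> = (\<Oplus>\<^bsub>R\<^esub>u \<in> ?A. if Comp C h (Comp C f u) = g then a u else \<zero>\<^bsub>R\<^esub>)"
    proof (rule finsum_cong')
      fix u assume "u \<in> ?A"
      then show "(\<Oplus>\<^bsub>R\<^esub>v \<in> ?B. if Comp C f u = v then (if Comp C h v = g then a u else \<zero>\<^bsub>R\<^esub>) else \<zero>\<^bsub>R\<^esub>)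
        = (if Comp C h (Comp C f u) = g then a u else \<zero>\<^bsub>R\<^esub>)"
        using A by (intro add.finprod_singleton) (auto simp: car[OF a])
    qed (auto simp: car[OF a])
    also have "\<dots> = (\<Oplus>\<^bsub>R\<^esub>u \<in> ?A. if Comp C (Comp C h f) u = g then a u else \<zero>\<^bsub>R\<^esub>)"
      by (rule finsum_cong') (auto simp: car[OF a] Comp_assoc[OF supp[OF a] f' h'])
    also have "\<dots> = rep_map ?P (Comp C h f) a g"
      by (rule rm[OF Comp_in[OF f' h'] a A(1) order_refl, symmetric])
    finally show "rep_map ?P (Comp C h f) a g = rep_map ?P h ?b g" by simp
  qed
  show ?thesis
    unfolding representation_def
    by (auto simp: obj left_module_free_left_module[OF R] hom[unfolded obj] ident comp)
qed

end

theory Submission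
  imports Defs "HOL-Library.Infinite_Set"
begin

text \<open>
  The Groebner category behind \<open>FS\<^sub>G\<^sup>o\<^sup>p\<close> is \<open>OS\<^sup>o\<^sup>p\<close>, where \<open>OS\<close> consists of the finite ordinals and
  the surjections whose fibres have increasing minima, and the functor is the inclusion that gives all
  points trivial weight. An arrow of \<open>OS\<^sup>o\<^sup>p\<close> out of the ordinal \<open>n\<close> is a word in \<open>n\<close> letters, and
  composition is precomposition with an ordered surjection \<open>h\<close>. Lexicographic order is preserved
  strictly, because the first difference of \<open>f \<circ> h\<close> and \<open>g \<circ> h\<close> is the least point over the first
  difference of \<open>f\<close> and \<open>g\<close> (\<open>lex_less_comp_ordered_surj\<close>). A word precomposed with an ordered
  surjection is the word with some repetitions of earlier letters inserted, and a minimal bad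
  sequence argument shows that this order on words is noetherian (\<open>expands_good_pair\<close>).

  Property (F) is where finiteness of \<open>G\<close> enters. A G-map to \<open>R\<close> is a function to \<open>R \<times> G\<close>;
  numbering its values by first occurrence writes it as an ordered surjection followed by a G-map whose
  source has at most \<open>\<bar>R\<bar> \<cdot> \<bar>G\<bar>\<close> elements (\<open>FS_factorization\<close>), so finitely many G-maps to \<open>R\<close> suffice.

  For the consequence on representations, property (F) makes the pullback of a finitely generated
  representation to the Groebner category finitely generated, and essential surjectivity makes
  \<open>F\<close> noetherian if its pullback is. Over a Groebner category a finitely generated representation is
  treated as polynomials are in Hilbert's basis theorem: the generators are images of terms, which
  are well-ordered. A subrepresentation has a left ideal of leading coefficients at each term, these ideals
  grow along divisibility of terms, and by division with remainder they determine the
  subrepresentation within a larger one (\<open>subrep_eq_if_initial_eq\<close>). As divisibility of terms is a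
  noetherian order and the ring is left-noetherian, in an ascending chain of subrepresentations all
  leading ideals become stationary at a common step (\<open>initial_stabilizes\<close>). Leading terms are taken
  with respect to a spanning family that may have relations, so the argument applies directly to quotients of
  projectives.
\<close>

section \<open>Words under insertion of repeated letters\<close>

text \<open>Nash-Williams: choose the terms one after the other, each of least size among all bad sequences
  that continue the choice made so far.\<close>

lemma minimal_bad_sequence:
  fixes r :: "'a \<Rightarrow> 'a \<Rightarrow> bool" and \<mu> :: "'a \<Rightarrow> nat" and A :: "'a set"
  defines "bad \<equiv> \<lambda>s :: nat \<Rightarrow> 'a. range s \<subseteq> A \<and> (\<forall>i j. i < j \<longrightarrow> \<not> r (s i) (s j))"
  assumes "bad s"
  obtains m where "bad m" "\<And>n t. bad t \<Longrightarrow> (\<And>i. i < n \<Longrightarrow> t i = m i) \<Longrightarrow> \<mu> (m n) \<le> \<mu> (t n)"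
proof -
  define least where "least n t \<longleftrightarrow>
    bad t \<and> (\<forall>u. bad u \<and> (\<forall>i<n. u i = t i) \<longrightarrow> \<mu> (t n) \<le> \<mu> (u n))" for n t
  have step: "\<exists>t'. least n t' \<and> (\<forall>i<n. t' i = t i)" if "bad t" for n t
  proof -
    let ?P = "\<lambda>u. bad u \<and> (\<forall>i<n. u i = t i)"
    obtain t' where "?P t'" "\<And>u. ?P u \<Longrightarrow> \<mu> (t' n) \<le> \<mu> (u n)"
      using ex_has_least_nat[of ?P t "\<lambda>u. \<mu> (u n)"] \<open>bad t\<close> by blast
    then show ?thesis by (auto simp: least_def)
  qed
  have "\<exists>F. \<forall>n. least n (F n) \<and> (\<forall>i<Suc n. F (Suc n) i = F n i)"
  proof (rule dependent_nat_choice)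
    show "\<exists>t. least 0 t" using step[OF \<open>bad s\<close>] by blast
    show "\<exists>t'. least (Suc n) t' \<and> (\<forall>i<Suc n. t' i = t i)" if "least n t" for n t
      using step[of t "Suc n"] that by (simp add: least_def)
  qed
  then obtain F where F: "\<And>n. least n (F n)" "\<And>n i. i < Suc n \<Longrightarrow> F (Suc n) i = F n i"
    by blast
  \<comment> \<open>the bad sequences \<open>F 0, F 1, \<dots>\<close> agree on longer and longer prefixes, hence have a limit\<close>
  have stable: "F j i = F i i" if "i \<le> j" for i j
    using that by (induction rule: dec_induct) (auto simp: F(2))
  have bad_F: "bad (F n)" for n using F(1) by (simp add: least_def)
  show thesis
  proof (rule that[of "\<lambda>n. F n n"])
    show "bad (\<lambda>n. F n n)"
      unfolding bad_def
    proof (intro conjI allI impI)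
      show "range (\<lambda>n. F n n) \<subseteq> A" using bad_F unfolding bad_def by auto
      show "\<not> r (F i i) (F j j)" if "i < j" for i j
        using bad_F[of j] stable[of i j] that unfolding bad_def by (metis less_imp_le)
    qed
    show "\<mu> (F n n) \<le> \<mu> (t n)" if "bad t" "\<And>i. i < n \<Longrightarrow> t i = F i i" for n t
    proof -
      have "t i = F n i" if "i < n" for i
        using \<open>i < n\<close> stable[of i n] \<open>\<And>i. i < n \<Longrightarrow> t i = F i i\<close> by simp
      then show ?thesis using F(1)[of n] \<open>bad t\<close> unfolding least_def by blast
    qed
  qed
qed

text \<open>Words are read from right to left, so that the tail of a list is its past. The relation \<open>expands v w\<close>
  says that \<open>w\<close> arises from \<open>v\<close> by inserting letters each of which repeats a letter that was
  already present in its past; this is the same as \<open>w = v \<circ> h\<close> for an ordered surjection \<open>h\<close> of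
  positions. It is stronger than the subword order of Higman's lemma.\<close>

inductive expands :: "'a list \<Rightarrow> 'a list \<Rightarrow> bool" where
  empty: "expands [] []"
| keep: "expands v w \<Longrightarrow> expands (a # v) (a # w)"
| repeat: "expands v w \<Longrightarrow> a \<in> set v \<Longrightarrow> expands v (a # w)"

lemma expands_refl: "expands v v"
  by (induction v) (auto intro: expands.intros)

lemma expands_set_eq: "expands v w \<Longrightarrow> set v = set w"
  by (induction rule: expands.induct) auto

lemma expands_insert_repetition:
  "expands s (t @ u) \<Longrightarrow> p \<in> set u \<Longrightarrow> expands s (t @ p # u)"
proof (induction t arbitrary: s)
  case Nil
  then show ?case using expands_set_eq by (fastforce intro: expands.intros)
next
  case (Cons a t)
  from Cons.prems(1) show ?case
    by (cases rule: expands.cases) (use Cons in \<open>auto intro: expands.intros\<close>)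
qed

text \<open>A letter of \<open>t\<close> occurs just once in \<open>t @ v\<close>, so it cannot have been inserted as a repetition and
  must be matched with itself.\<close>

lemma expands_cancel_exceptional:
  "expands (t @ u) (t @ v) \<Longrightarrow> distinct t \<Longrightarrow> set t \<inter> set v = {} \<Longrightarrow> expands u v"
proof (induction t)
  case (Cons a t)
  from Cons.prems(1) have "expands (t @ u) (t @ v)"
  proof (cases rule: expands.cases)
    case repeat
    then have "a \<in> set (t @ v)" using expands_set_eq by fastforce
    then show ?thesis using Cons.prems by auto
  qed auto
  then show ?case using Cons by auto
qed auto

lemma expands_append: "expands u v \<Longrightarrow> expands (t @ u) (t @ v)"
  by (induction t) (auto intro: expands.intros)

text \<open>The split at the first letter, in the order of the list, that occurs again further on. The letters
  of \<open>t\<close> are then exceptional, that is, they occur only once, so over a finite alphabet there are only finitely many pairs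
  \<open>(t, p)\<close>.\<close>

lemma first_repeated_letter:
  "\<not> distinct l \<Longrightarrow> \<exists>t p u. l = t @ p # u \<and> distinct t \<and> set t \<inter> set u = {} \<and> p \<in> set u"
proof (induction l)
  case (Cons a l)
  show ?case
  proof (cases "a \<in> set l")
    case True
    then show ?thesis by (intro exI[of _ "[]"] exI[of _ a] exI[of _ l]) auto
  next
    case False
    then obtain t p u where "l = t @ p # u" "distinct t" "set t \<inter> set u = {}" "p \<in> set u"
      using Cons by auto
    then show ?thesis using False
      by (intro exI[of _ "a # t"] exI[of _ p] exI[of _ u]) auto
  qed
qed simp

text \<open>The factorization order on words is noetherian by the argument of Nash-Williams: in a minimal bad sequence, infinitely many words have a repeated letter, and passing to a subsequence
  one may assume that they have the same initial segment \<open>t\<close> of exceptional letters and the same first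
  repeated letter \<open>p\<close>. Deleting this \<open>p\<close> from all of them would give a bad sequence again: a good
  pair among the shortened words extends to the original ones because \<open>t\<close> can be cancelled and
  \<open>p\<close> reinserted on both sides, and a good pair between an old word and a shortened one survives
  the insertion of a repetition. This contradicts minimality.\<close>

theorem expands_good_pair:
  fixes s :: "nat \<Rightarrow> 'a list"
  assumes "finite A" and words: "\<And>i. set (s i) \<subseteq> A"
  shows "\<exists>i j. i < j \<and> expands (s i) (s j)"
proof (rule ccontr)
  assume "\<not> ?thesis"
  then have "range s \<subseteq> lists A \<and> (\<forall>i j. i < j \<longrightarrow> \<not> expands (s i) (s j))"
    using words by auto
  then obtain m :: "nat \<Rightarrow> 'a list" where m: "range m \<subseteq> lists A" "\<And>i j. i < j \<Longrightarrow> \<not> expands (m i) (m j)"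
    and least: "\<And>n t. range t \<subseteq> lists A \<and> (\<forall>i j. i < j \<longrightarrow> \<not> expands (t i) (t j)) \<Longrightarrow>
      (\<And>i. i < n \<Longrightarrow> t i = m i) \<Longrightarrow> length (m n) \<le> length (t n)"
    by (rule minimal_bad_sequence[where \<mu> = length]) blast
  have "inj m"
    using m(2) expands_refl by (metis injI linorder_neqE_nat)
  have fin: "finite {t. distinct t \<and> set t \<subseteq> A}"
    using finite_subset_distinct[OF \<open>finite A\<close>] by (simp add: conj_commute)
  have "finite {i. distinct (m i)}"
  proof (rule finite_imageD)
    show "finite (m ` {i. distinct (m i)})"
      by (rule finite_subset[OF _ fin]) (use m(1) in auto)
    show "inj_on m {i. distinct (m i)}" using \<open>inj m\<close> inj_on_subset by blast
  qed
  then have inf: "infinite {i. \<not> distinct (m i)}"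
    using infinite_UNIV_nat finite_Collect_not by blast
  have "\<exists>x. \<not> distinct (m i) \<longrightarrow> m i = fst x @ fst (snd x) # snd (snd x) \<and> distinct (fst x) \<and>
      set (fst x) \<inter> set (snd (snd x)) = {} \<and> fst (snd x) \<in> set (snd (snd x))" for i
    using first_repeated_letter[of "m i"] by auto
  then obtain x where x: "\<And>i. \<not> distinct (m i) \<Longrightarrow> m i = fst (x i) @ fst (snd (x i)) # snd (snd (x i)) \<and>
      distinct (fst (x i)) \<and> set (fst (x i)) \<inter> set (snd (snd (x i))) = {} \<and>
      fst (snd (x i)) \<in> set (snd (snd (x i)))"
    by metis
  define t p u where "t i = fst (x i)" and "p i = fst (snd (x i))" and "u i = snd (snd (x i))" for i
  note tpu = x[folded t_def p_def u_def]
  have "(\<lambda>i. (t i, p i)) ` {i. \<not> distinct (m i)} \<subseteq> {t. distinct t \<and> set t \<subseteq> A} \<times> A"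
  proof safe
    fix i x assume i: "\<not> distinct (m i)"
    have "set (m i) \<subseteq> A" using m(1) by auto
    then show "distinct (t i)" "x \<in> set (t i) \<Longrightarrow> x \<in> A" "p i \<in> A"
      using tpu[OF i] by auto
  qed
  then obtain k where k: "infinite {i \<in> {i. \<not> distinct (m i)}. (t i, p i) = (t k, p k)}"
    using pigeonhole_infinite[OF inf, of "\<lambda>i. (t i, p i)"] fin \<open>finite A\<close>
    by (meson finite_SigmaI finite_subset)
  define I where "I = {i. \<not> distinct (m i) \<and> t i = t k \<and> p i = p k}"
  have "infinite I" using k by (simp add: I_def)
  define \<phi> where "\<phi> = enumerate I"
  have \<phi>_in: "\<phi> i \<in> I" for i unfolding \<phi>_def by (rule enumerate_in_set[OF \<open>infinite I\<close>])
  have \<phi>_mono: "i < j \<Longrightarrow> \<phi> i < \<phi> j" for i j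
    unfolding \<phi>_def by (rule enumerate_mono[OF _ \<open>infinite I\<close>])
  have dec: "m i = t k @ p k # u i" "distinct (t k)" "set (t k) \<inter> set (u i) = {}" "p k \<in> set (u i)"
    if "i \<in> I" for i using tpu[of i] that by (auto simp: I_def)
  \<comment> \<open>the old sequence up to the first index in \<open>I\<close>, followed by the shortened words\<close>
  define s' where "s' i = (if i < \<phi> 0 then m i else t k @ u (\<phi> (i - \<phi> 0)))" for i
  have "length (m (\<phi> 0)) \<le> length (s' (\<phi> 0))"
  proof (rule least, intro conjI allI impI)
    have mA: "set (m i) \<subseteq> A" for i using m(1) by auto
    moreover have "set (t k @ u (\<phi> i)) \<subseteq> A" for i
      using mA[of "\<phi> i"] dec(1)[OF \<phi>_in[of i]] by auto
    ultimately have "set (s' i) \<subseteq> A" for i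
      unfolding s'_def by simp
    then show "range s' \<subseteq> lists A" by auto
    fix i j :: nat assume "i < j"
    show "\<not> expands (s' i) (s' j)"
    proof
      assume E: "expands (s' i) (s' j)"
      show False
      proof (cases "j < \<phi> 0")
        case True
        then show False using E m(2) \<open>i < j\<close> by (simp add: s'_def)
      next
        case False
        define j' where "j' = \<phi> (j - \<phi> 0)"
        have j': "j' \<in> I" by (simp add: j'_def \<phi>_in)
        have sj: "s' j = t k @ u j'" using False by (simp add: s'_def j'_def)
        show False
        proof (cases "i < \<phi> 0")
          case True
          then have "expands (m i) (m j')"
            using E expands_insert_repetition[of "m i" "t k" "u j'" "p k"] dec[OF j']
            by (simp add: s'_def sj[unfolded s'_def])
          moreover have "\<phi> 0 \<le> j'" unfolding j'_def using \<phi>_mono[of 0] by (cases "j - \<phi> 0") (auto intro: less_imp_le)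
          ultimately show False using m(2) True by auto
        next
          case ni: False
          define i' where "i' = \<phi> (i - \<phi> 0)"
          have i': "i' \<in> I" by (simp add: i'_def \<phi>_in)
          have "s' i = t k @ u i'" using ni by (simp add: s'_def i'_def)
          \<comment> \<open>both words were shortened: cancel \<open>t\<close>, then put \<open>p\<close> and \<open>t\<close> back\<close>
          then have "expands (u i') (u j')"
            using E sj expands_cancel_exceptional dec[OF j'] by metis
          then have "expands (m i') (m j')"
            unfolding dec(1)[OF i'] dec(1)[OF j'] by (intro expands_append expands.keep)
          moreover have "i' < j'" unfolding i'_def j'_def using \<open>i < j\<close> ni by (intro \<phi>_mono) auto
          ultimately show False using m(2) by blast
        qed
      qed
    qed
  qed (simp add: s'_def)
  then show False using dec(1)[OF \<phi>_in[of 0]] by (simp add: s'_def)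
qed

section \<open>Ordered surjections\<close>

text \<open>A surjection of finite ordinals is ordered if its fibres are listed by increasing minima. For a
  surjection this amounts to the restricted growth condition used here, that all values below
  \<open>h i\<close> are taken before \<open>i\<close>; in this form stability under composition is immediate.\<close>

definition ordered_surj :: "nat \<Rightarrow> nat \<Rightarrow> (nat \<Rightarrow> nat) \<Rightarrow> bool" where
  "ordered_surj m n h \<longleftrightarrow> h ` {..<m} = {..<n} \<and> (\<forall>i<m. \<forall>k<h i. \<exists>j<i. h j = k)"

lemma ordered_surj_lt: "ordered_surj m n h \<Longrightarrow> i < m \<Longrightarrow> h i < n"
  by (auto simp: ordered_surj_def)

lemma ordered_surj_id: "ordered_surj n n (\<lambda>i. i)"
  by (auto simp: ordered_surj_def)

lemma ordered_surj_comp: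
  assumes h: "ordered_surj m n h" and g: "ordered_surj n p g"
  shows "ordered_surj m p (\<lambda>i. g (h i))"
  unfolding ordered_surj_def
proof (intro conjI allI impI)
  have "(\<lambda>i. g (h i)) ` {..<m} = g ` h ` {..<m}" by (simp add: image_image)
  then show "(\<lambda>i. g (h i)) ` {..<m} = {..<p}" using h g by (simp add: ordered_surj_def)
  fix i k assume "i < m" "k < g (h i)"
  then obtain j where "j < h i" "g j = k" using ordered_surj_lt[OF h] g unfolding ordered_surj_def by blast
  then show "\<exists>j<i. g (h j) = k" using h \<open>i < m\<close> unfolding ordered_surj_def by blast
qed

text \<open>The two ways to extend an ordered surjection by one more point: the new point repeats an old value
  or takes the next unused one.\<close>

lemma ordered_surj_Suc:
  assumes "ordered_surj m n h" and "k < n \<and> n' = n \<or> k = n \<and> n' = Suc n"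
  shows "ordered_surj (Suc m) n' (h(m := k))"
proof -
  have *: "h ` {..<m} = {..<n}" "\<forall>i<m. \<forall>k<h i. \<exists>j<i. h j = k"
    using assms(1) by (auto simp: ordered_surj_def)
  have "h(m := k) ` {..<Suc m} = insert k (h ` {..<m})"
    by (auto simp: lessThan_Suc)
  then have "h(m := k) ` {..<Suc m} = {..<n'}"
    using assms(2) * by auto
  moreover have "\<exists>j<i. (h(m := k)) j = l" if "i < Suc m" "l < (h(m := k)) i" for i l
  proof (cases "i = m")
    case True
    then have "l \<in> h ` {..<m}" using that assms(2) * by auto
    then show ?thesis using True by auto
  next
    case False
    then have "i < m" "l < h i" using that by auto
    then obtain j where "j < i" "h j = l" using * by blast
    then show ?thesis using \<open>i < m\<close> by (intro exI[of _ j]) auto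
  qed
  ultimately show ?thesis by (simp add: ordered_surj_def)
qed

text \<open>Each rule of \<open>expands\<close> extends the surjection between positions by one point: a kept letter opens
  a new fibre, a repeated letter joins the fibre of an earlier occurrence.\<close>

lemma expands_imp_ordered_surj:
  assumes "expands v w"
  shows "\<exists>h. ordered_surj (length w) (length v) h \<and> (\<forall>i<length w. rev w ! i = rev v ! h i)"
  using assms
proof (induction rule: expands.induct)
  case empty
  show ?case by (auto simp: ordered_surj_def)
next
  case (keep v w a)
  then obtain h where h: "ordered_surj (length w) (length v) h" "\<And>i. i < length w \<Longrightarrow> rev w ! i = rev v ! h i"
    by blast
  show ?case
  proof (intro exI conjI)
    show "ordered_surj (length (a # w)) (length (a # v)) (h(length w := length v))"
      using ordered_surj_Suc[OF h(1), of "length v" "Suc (length v)"] by simp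
    show "\<forall>i<length (a # w). rev (a # w) ! i = rev (a # v) ! (h(length w := length v)) i"
      using ordered_surj_lt[OF h(1)] h(2) by (auto simp: nth_append less_Suc_eq)
  qed
next
  case (repeat v w a)
  then obtain h where h: "ordered_surj (length w) (length v) h" "\<And>i. i < length w \<Longrightarrow> rev w ! i = rev v ! h i"
    by blast
  obtain k where "k < length v" "rev v ! k = a"
    using repeat by (metis in_set_conv_nth length_rev set_rev)
  show ?case
  proof (intro exI conjI)
    show "ordered_surj (length (a # w)) (length v) (h(length w := k))"
      using ordered_surj_Suc[OF h(1), of k "length v"] \<open>k < length v\<close> by simp
    show "\<forall>i<length (a # w). rev (a # w) ! i = rev v ! (h(length w := k)) i"
      using ordered_surj_lt[OF h(1)] h(2) \<open>rev v ! k = a\<close> by (auto simp: nth_append less_Suc_eq)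
  qed
qed

text \<open>The functions \<open>f i\<close> are words in the alphabet \<open>{..<n}\<close>. The lists are reversed because
  \<open>expands\<close> treats the tail of a list as the part that was read earlier.\<close>

lemma ordered_surj_good_pair:
  assumes "\<And>i :: nat. ordered_surj (m i) n (f i)"
  shows "\<exists>i j h. i < j \<and> ordered_surj (m j) (m i) h \<and> (\<forall>x<m j. f j x = f i (h x))"
proof -
  define s where "s i = rev (map (f i) [0..<m i])" for i
  have "set (s i) \<subseteq> {..<n}" for i using ordered_surj_lt[OF assms] by (auto simp: s_def)
  then obtain i j where ij: "i < j" "expands (s i) (s j)"
    using expands_good_pair[of "{..<n}" s] by auto
  obtain h where "ordered_surj (m j) (m i) h" "\<forall>x<m j. rev (s j) ! x = rev (s i) ! h x"
    using expands_imp_ordered_surj[OF ij(2)] by (auto simp: s_def)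
  then show ?thesis using \<open>i < j\<close> ordered_surj_lt[of "m j" "m i" h]
    by (intro exI[of _ i] exI[of _ j] exI[of _ h]) (auto simp: s_def)
qed

text \<open>Numbering the values of \<open>q\<close> in the order of their first occurrence factors \<open>q\<close> through an ordered
  surjection onto its image.\<close>

lemma ordered_surj_factorization:
  "\<exists>p g c. ordered_surj m p g \<and> bij_betw c {..<p} (q ` {..<m}) \<and> (\<forall>i<m. q i = c (g i))"
proof (induction m)
  case 0
  show ?case by (intro exI[of _ 0]) (auto simp: ordered_surj_def bij_betw_def)
next
  case (Suc m)
  then obtain p g c where *: "ordered_surj m p g" "bij_betw c {..<p} (q ` {..<m})" "\<And>i. i < m \<Longrightarrow> q i = c (g i)"
    by blast
  show ?case
  proof (cases "q m \<in> q ` {..<m}")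
    case True
    then obtain k where k: "k < p" "c k = q m" using *(2) unfolding bij_betw_def by (metis imageE lessThan_iff)
    have "q ` {..<Suc m} = q ` {..<m}" using True by (auto simp: lessThan_Suc)
    moreover have "ordered_surj (Suc m) p (g(m := k))"
      using ordered_surj_Suc[OF *(1), of k p] k by simp
    moreover have "\<forall>i<Suc m. q i = c ((g(m := k)) i)"
      using *(3) k by (simp add: less_Suc_eq)
    ultimately show ?thesis using *(2) by metis
  next
    case False
    have "c x \<noteq> q m" if "x < p" for x
      using that False bij_betwE[OF *(2)] by (metis lessThan_iff)
    then have "bij_betw (c(p := q m)) {..<Suc p} (q ` {..<Suc m})"
      using *(2) by (auto simp: bij_betw_def lessThan_Suc inj_on_def) blast+
    moreover have "ordered_surj (Suc m) (Suc p) (g(m := p))"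
      using ordered_surj_Suc[OF *(1), of p "Suc p"] by simp
    moreover have "q i = (c(p := q m)) ((g(m := p)) i)" if "i < Suc m" for i
      using *(3)[of i] ordered_surj_lt[OF *(1), of i] that by (cases "i = m") auto
    ultimately show ?thesis by blast
  qed
qed

definition lex_less :: "nat \<Rightarrow> (nat \<Rightarrow> nat) \<Rightarrow> (nat \<Rightarrow> nat) \<Rightarrow> bool" where
  "lex_less n f g \<longleftrightarrow> (\<exists>i<n. (\<forall>j<i. f j = g j) \<and> f i < g i)"

lemma lex_less_irrefl: "\<not> lex_less n f f"
  by (auto simp: lex_less_def)

lemma lex_less_trans: "lex_less n f g \<Longrightarrow> lex_less n g h \<Longrightarrow> lex_less n f h"
  unfolding lex_less_def
proof safe
  fix i i'
  assume "i < n" "i' < n" "\<forall>j<i. f j = g j" "f i < g i" "\<forall>j<i'. g j = h j" "g i' < h i'"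
  then show "\<exists>i<n. (\<forall>j<i. f j = h j) \<and> f i < h i"
    by (intro exI[of _ "min i i'"]) (cases i i' rule: linorder_cases, auto)
qed

lemma lex_less_total:
  assumes "\<exists>i<n. f i \<noteq> g i"
  shows "lex_less n f g \<or> lex_less n g f"
proof -
  define i where "i = (LEAST i. f i \<noteq> g i)"
  obtain k where k: "k < n" "f k \<noteq> g k" using assms by blast
  have "f i \<noteq> g i" unfolding i_def by (rule LeastI) (fact k(2))
  moreover have "i \<le> k" unfolding i_def by (rule Least_le) (fact k(2))
  moreover have "f j = g j" if "j < i" for j using that not_less_Least unfolding i_def by blast
  ultimately show ?thesis using k unfolding lex_less_def by (metis linorder_neqE_nat order_le_less_trans)
qed

lemma lex_less_cong:
  assumes "lex_less n f g" "\<forall>i<n. f i = f' i" "\<forall>i<n. g i = g' i"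
  shows "lex_less n f' g'"
proof -
  obtain i where i: "i < n" "\<forall>j<i. f j = g j" "f i < g i"
    using assms(1) by (auto simp: lex_less_def)
  then have "\<forall>j<i. f' j = g' j" "f' i < g' i" using assms(2,3) by auto
  then show ?thesis using i(1) by (auto simp: lex_less_def)
qed

text \<open>If \<open>i\<close> is the first place where \<open>f\<close> and \<open>g\<close> differ, then the first place where \<open>f \<circ> h\<close> and
  \<open>g \<circ> h\<close> differ is the minimum \<open>a\<close> of the fibre of \<open>h\<close> over \<open>i\<close>: since \<open>h\<close> is ordered, it takes
  only values below \<open>i\<close> before \<open>a\<close>. For an arbitrary surjection this fails.\<close>

lemma lex_less_comp_ordered_surj:
  assumes "lex_less n f g" and h: "ordered_surj m n h"
  shows "lex_less m (\<lambda>x. f (h x)) (\<lambda>x. g (h x))"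
proof -
  obtain i where i: "i < n" "\<And>j. j < i \<Longrightarrow> f j = g j" "f i < g i"
    using assms(1) by (auto simp: lex_less_def)
  then obtain k where k: "k < m" "h k = i" using h unfolding ordered_surj_def by (metis imageE lessThan_iff)
  define a where "a = (LEAST a. h a = i)"
  have a: "h a = i" unfolding a_def by (rule LeastI[of _ k]) (fact k)
  have "a \<le> k" unfolding a_def by (rule Least_le) (fact k)
  have "h b < i" if "b < a" for b
  proof (rule ccontr)
    assume "\<not> h b < i"
    moreover have "h b \<noteq> i" using that not_less_Least unfolding a_def by blast
    ultimately obtain c where "c < b" "h c = i"
      using h \<open>a \<le> k\<close> \<open>b < a\<close> k(1) unfolding ordered_surj_def by (metis linorder_neqE_nat order.strict_trans2 order.strict_trans)
    then show False using \<open>b < a\<close> not_less_Least[of c "\<lambda>a. h a = i"] unfolding a_def by simp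
  qed
  then show ?thesis using a i \<open>a \<le> k\<close> k(1) unfolding lex_less_def by (intro exI[of _ a]) auto
qed

section \<open>Ascending subsequences and spans in left modules\<close>

text \<open>Only finitely many indices fail to have a successor, since infinitely many of them would form a
  bad sequence. Beyond them, successors can be chosen one after the other.\<close>

lemma ascending_subsequence:
  fixes s :: "nat \<Rightarrow> 'a"
  assumes good: "\<And>s' :: nat \<Rightarrow> 'a. range s' \<subseteq> A \<Longrightarrow> \<exists>i j. i < j \<and> Q (s' i) (s' j)"
    and s: "range s \<subseteq> A"
  shows "\<exists>\<phi> :: nat \<Rightarrow> nat. \<forall>i. \<phi> i < \<phi> (Suc i) \<and> Q (s (\<phi> i)) (s (\<phi> (Suc i)))"
proof -
  define X where "X = {i. \<forall>j>i. \<not> Q (s i) (s j)}"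
  have "finite X"
  proof (rule ccontr)
    assume inf: "infinite X"
    have "range (s \<circ> enumerate X) \<subseteq> A" using s by auto
    from good[OF this] obtain i j where "i < j" "Q (s (enumerate X i)) (s (enumerate X j))"
      by auto
    then show False
      using enumerate_in_set[OF inf, of i] enumerate_mono[OF _ inf, of i j] by (auto simp: X_def)
  qed
  then obtain b where b: "\<And>i. i \<in> X \<Longrightarrow> i < b" using finite_nat_set_iff_bounded by auto
  have "\<exists>\<phi>. \<forall>i. b \<le> \<phi> i \<and> (\<phi> i < \<phi> (Suc i) \<and> Q (s (\<phi> i)) (s (\<phi> (Suc i))))"
  proof (rule dependent_nat_choice)
    fix i assume "b \<le> i"
    then have "i \<notin> X" using b[of i] by auto
    then obtain j where "i < j" "Q (s i) (s j)" by (auto simp: X_def)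
    then show "\<exists>j\<ge>b. i < j \<and> Q (s i) (s j)" using \<open>b \<le> i\<close> by (intro exI[of _ j]) simp
  qed auto
  then show ?thesis by blast
qed

text \<open>The span is generated inductively rather than by finite sums, which gives one-step inductions for
  everything below.\<close>

inductive_set lspan :: "('k, 'z) ring_scheme \<Rightarrow> ('k, 'v, 'w) module_scheme \<Rightarrow> 'v set \<Rightarrow> 'v set"
  for R M S where
  zero: "\<zero>\<^bsub>M\<^esub> \<in> lspan R M S"
| step: "c \<in> carrier R \<Longrightarrow> s \<in> S \<Longrightarrow> v \<in> lspan R M S \<Longrightarrow> c \<odot>\<^bsub>M\<^esub> s \<oplus>\<^bsub>M\<^esub> v \<in> lspan R M S"

lemma lspan_mono: "S \<subseteq> S' \<Longrightarrow> lspan R M S \<subseteq> lspan R M S'"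
proof
  fix v assume "S \<subseteq> S'" "v \<in> lspan R M S"
  from this(2) show "v \<in> lspan R M S'"
    by (induction rule: lspan.induct) (use \<open>S \<subseteq> S'\<close> in \<open>auto intro: lspan.intros\<close>)
qed

context left_module
begin

lemma lsmult_zero_left: "x \<in> carrier M \<Longrightarrow> \<zero> \<odot>\<^bsub>M\<^esub> x = \<zero>\<^bsub>M\<^esub>"
proof -
  assume x: "x \<in> carrier M"
  have "\<zero> \<odot>\<^bsub>M\<^esub> x \<oplus>\<^bsub>M\<^esub> \<zero> \<odot>\<^bsub>M\<^esub> x = \<zero> \<odot>\<^bsub>M\<^esub> x"
    using x lsmult_l_distr[of \<zero> \<zero> x] by simp
  then show ?thesis using x lsmult_closed[of \<zero> x] M.add.r_cancel_one' by auto
qed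

lemma lsmult_zero_right: "a \<in> carrier R \<Longrightarrow> a \<odot>\<^bsub>M\<^esub> \<zero>\<^bsub>M\<^esub> = \<zero>\<^bsub>M\<^esub>"
proof -
  assume a: "a \<in> carrier R"
  have "a \<odot>\<^bsub>M\<^esub> \<zero>\<^bsub>M\<^esub> \<oplus>\<^bsub>M\<^esub> a \<odot>\<^bsub>M\<^esub> \<zero>\<^bsub>M\<^esub> = a \<odot>\<^bsub>M\<^esub> \<zero>\<^bsub>M\<^esub>"
    using a lsmult_r_distr[of a "\<zero>\<^bsub>M\<^esub>" "\<zero>\<^bsub>M\<^esub>"] by simp
  then show ?thesis using a lsmult_closed[of a "\<zero>\<^bsub>M\<^esub>"] M.add.r_cancel_one' by auto
qed

lemma lsmult_minus_one: "x \<in> carrier M \<Longrightarrow> (\<ominus> \<one>) \<odot>\<^bsub>M\<^esub> x = \<ominus>\<^bsub>M\<^esub> x"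
proof -
  assume x: "x \<in> carrier M"
  have "(\<ominus> \<one>) \<odot>\<^bsub>M\<^esub> x \<oplus>\<^bsub>M\<^esub> x = \<zero>\<^bsub>M\<^esub>"
    using x lsmult_l_distr[of "\<ominus> \<one>" \<one> x] by (simp add: lsmult_one lsmult_zero_left R.l_neg)
  then show ?thesis using x lsmult_closed[of "\<ominus> \<one>" x] M.minus_equality by simp
qed

lemma lspan_subset:
  assumes "S \<subseteq> carrier M" shows "lspan R M S \<subseteq> carrier M"
proof
  fix v assume "v \<in> lspan R M S"
  then show "v \<in> carrier M"
    by (induction rule: lspan.induct) (use assms lsmult_closed in auto)
qed

lemma lspan_add:
  assumes S: "S \<subseteq> carrier M" and "u \<in> lspan R M S" "v \<in> lspan R M S"
  shows "u \<oplus>\<^bsub>M\<^esub> v \<in> lspan R M S"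
  using assms(2)
proof (induction rule: lspan.induct)
  case zero
  then show ?case using lspan_subset[OF S] assms(3) by auto
next
  case (step c s u)
  have "c \<odot>\<^bsub>M\<^esub> s \<in> carrier M" "u \<in> carrier M" "v \<in> carrier M"
    using step S lspan_subset[OF S] assms(3) lsmult_closed by auto
  then show ?case using lspan.step[OF step(1,2) step.IH] by (simp add: M.a_assoc)
qed

lemma lspan_smult:
  assumes S: "S \<subseteq> carrier M" and a: "a \<in> carrier R" and "v \<in> lspan R M S"
  shows "a \<odot>\<^bsub>M\<^esub> v \<in> lspan R M S"
  using assms(3)
proof (induction rule: lspan.induct)
  case zero
  then show ?case using a by (simp add: lsmult_zero_right lspan.zero)
next
  case (step c s v)
  have *: "s \<in> carrier M" "v \<in> carrier M" using step S lspan_subset[OF S] by auto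
  then have "a \<odot>\<^bsub>M\<^esub> (c \<odot>\<^bsub>M\<^esub> s \<oplus>\<^bsub>M\<^esub> v) = (a \<otimes> c) \<odot>\<^bsub>M\<^esub> s \<oplus>\<^bsub>M\<^esub> a \<odot>\<^bsub>M\<^esub> v"
    using a step(1) by (simp add: lsmult_r_distr lsmult_assoc lsmult_closed)
  then show ?case using lspan.step[OF _ step(2) step.IH, of "a \<otimes> c"] a step(1) by simp
qed

lemma lspan_uminus:
  assumes "S \<subseteq> carrier M" "v \<in> lspan R M S" shows "\<ominus>\<^bsub>M\<^esub> v \<in> lspan R M S"
  using lspan_smult[OF assms(1) _ assms(2), of "\<ominus> \<one>"] lsmult_minus_one[of v]
    lspan_subset[OF assms(1)] assms(2) by auto

lemma lspan_insertE:
  assumes S: "insert s S \<subseteq> carrier M" and v: "v \<in> lspan R M (insert s S)"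
  obtains c u where "c \<in> carrier R" "u \<in> lspan R M S" "v = c \<odot>\<^bsub>M\<^esub> s \<oplus>\<^bsub>M\<^esub> u"
proof -
  from v have "\<exists>c\<in>carrier R. \<exists>u\<in>lspan R M S. v = c \<odot>\<^bsub>M\<^esub> s \<oplus>\<^bsub>M\<^esub> u"
  proof (induction rule: lspan.induct)
    case zero
    have "\<zero>\<^bsub>M\<^esub> = \<zero> \<odot>\<^bsub>M\<^esub> s \<oplus>\<^bsub>M\<^esub> \<zero>\<^bsub>M\<^esub>" using S by (simp add: lsmult_zero_left)
    then show ?case using lspan.zero by (metis R.zero_closed)
  next
    case (step d t v)
    then obtain c u where cu: "c \<in> carrier R" "u \<in> lspan R M S" "v = c \<odot>\<^bsub>M\<^esub> s \<oplus>\<^bsub>M\<^esub> u" by blast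
    have car: "t \<in> carrier M" "s \<in> carrier M" "u \<in> carrier M"
      using step(2) S lspan_subset[of S] cu(2) by auto
    show ?case
    proof (cases "t = s")
      case True
      have "d \<odot>\<^bsub>M\<^esub> t \<oplus>\<^bsub>M\<^esub> v = (d \<oplus> c) \<odot>\<^bsub>M\<^esub> s \<oplus>\<^bsub>M\<^esub> u"
        using car cu step(1) True by (simp add: lsmult_l_distr M.a_assoc lsmult_closed)
      then show ?thesis using cu step(1) by (intro bexI[of _ "d \<oplus> c"] bexI[of _ u]) auto
    next
      case False
      then have "d \<odot>\<^bsub>M\<^esub> t \<oplus>\<^bsub>M\<^esub> u \<in> lspan R M S" using step(1,2) cu(2) by (intro lspan.step) auto
      moreover have "d \<odot>\<^bsub>M\<^esub> t \<oplus>\<^bsub>M\<^esub> v = c \<odot>\<^bsub>M\<^esub> s \<oplus>\<^bsub>M\<^esub> (d \<odot>\<^bsub>M\<^esub> t \<oplus>\<^bsub>M\<^esub> u)"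
        using car cu step(1) by (simp add: lsmult_closed M.a_lcomm)
      ultimately show ?thesis using cu by blast
    qed
  qed
  then show thesis using that by blast
qed

end

lemma left_module_hom_zero:
  assumes "left_module R M" "left_module R N" "f \<in> left_module_hom R M N"
  shows "f \<zero>\<^bsub>M\<^esub> = \<zero>\<^bsub>N\<^esub>"
proof -
  interpret M: left_module R M by fact
  interpret N: left_module R N by fact
  have "f \<zero>\<^bsub>M\<^esub> = f (\<zero>\<^bsub>R\<^esub> \<odot>\<^bsub>M\<^esub> \<zero>\<^bsub>M\<^esub>)" by (simp add: M.lsmult_zero_left)
  also have "\<dots> = \<zero>\<^bsub>R\<^esub> \<odot>\<^bsub>N\<^esub> f \<zero>\<^bsub>M\<^esub>" using assms(3) by (simp add: left_module_hom_def)
  also have "\<dots> = \<zero>\<^bsub>N\<^esub>" by (rule N.lsmult_zero_left) (use assms(3) in \<open>auto simp: left_module_hom_def\<close>)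
  finally show ?thesis .
qed

lemma left_module_hom_lspan:
  assumes M: "left_module R M" and N: "left_module R N" and f: "f \<in> left_module_hom R M N"
    and S: "S \<subseteq> carrier M" and v: "v \<in> lspan R M S"
  shows "f v \<in> lspan R N (f ` S)"
  using v
proof (induction rule: lspan.induct)
  case zero
  then show ?case using left_module_hom_zero[OF M N f] by (simp add: lspan.zero)
next
  case (step c s v)
  interpret M: left_module R M by fact
  have "s \<in> carrier M" "v \<in> carrier M" "c \<odot>\<^bsub>M\<^esub> s \<in> carrier M"
    using step S M.lspan_subset[OF S] M.lsmult_closed by auto
  then have "f (c \<odot>\<^bsub>M\<^esub> s \<oplus>\<^bsub>M\<^esub> v) = c \<odot>\<^bsub>N\<^esub> f s \<oplus>\<^bsub>N\<^esub> f v"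
    using f step(1) by (simp add: left_module_hom_def)
  then show ?case using step by (auto intro: lspan.step)
qed

lemma submodule_facts:
  assumes "submodule N R M"
  shows "N \<subseteq> carrier M" "\<zero>\<^bsub>M\<^esub> \<in> N" "\<And>x y. x \<in> N \<Longrightarrow> y \<in> N \<Longrightarrow> x \<oplus>\<^bsub>M\<^esub> y \<in> N"
    "\<And>x. x \<in> N \<Longrightarrow> \<ominus>\<^bsub>M\<^esub> x \<in> N" "\<And>a x. a \<in> carrier R \<Longrightarrow> x \<in> N \<Longrightarrow> a \<odot>\<^bsub>M\<^esub> x \<in> N"
proof -
  interpret submodule N R M by fact
  show "N \<subseteq> carrier M" "\<zero>\<^bsub>M\<^esub> \<in> N" "\<And>x y. x \<in> N \<Longrightarrow> y \<in> N \<Longrightarrow> x \<oplus>\<^bsub>M\<^esub> y \<in> N"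
    "\<And>x. x \<in> N \<Longrightarrow> \<ominus>\<^bsub>M\<^esub> x \<in> N" "\<And>a x. a \<in> carrier R \<Longrightarrow> x \<in> N \<Longrightarrow> a \<odot>\<^bsub>M\<^esub> x \<in> N"
    using subset one_closed m_closed m_inv_closed smult_closed by (auto simp: a_inv_def)
qed

section \<open>Leading ideals and division with remainder\<close>

text \<open>A representation with a Groebner structure on its generators. The terms in \<open>T z\<close> are formal names
  for generators \<open>e t\<close> of the module at \<open>z\<close>, well-ordered by \<open>less z\<close>; arrows act on terms compatibly
  with \<open>e\<close> and strictly monotonically. The assumption \<open>good_pair\<close> says that divisibility of terms,
  where \<open>t\<close> divides \<open>act h t\<close>, is a noetherian order. Working with terms instead of the generators
  themselves allows the generators to satisfy relations, so that quotients of projectives are covered directly.\<close>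

locale ordered_generators =
  fixes R :: "('k, 'z) ring_scheme" and C :: "('o, 'm) cat" and F :: "('o, 'm, 'k, 'v) rep"
    and T :: "'o \<Rightarrow> 't set" and less :: "'o \<Rightarrow> 't rel"
    and e :: "'t \<Rightarrow> 'v" and act :: "'m \<Rightarrow> 't \<Rightarrow> 't"
  assumes left_noetherian: "left_noetherian R"
    and rep: "representation R C F"
    and less_in: "z \<in> Obj C \<Longrightarrow> less z \<subseteq> T z \<times> T z"
    and less_wf: "z \<in> Obj C \<Longrightarrow> wf (less z)"
    and less_trans: "z \<in> Obj C \<Longrightarrow> trans (less z)"
    and less_total: "z \<in> Obj C \<Longrightarrow> total_on (T z) (less z)"
    and e_in: "z \<in> Obj C \<Longrightarrow> t \<in> T z \<Longrightarrow> e t \<in> carrier (rep_obj F z)"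
    and span: "z \<in> Obj C \<Longrightarrow> carrier (rep_obj F z) \<subseteq> lspan R (rep_obj F z) (e ` T z)"
    and rep_map_e: "h \<in> Arr C \<Longrightarrow> t \<in> T (Dom C h) \<Longrightarrow> rep_map F h (e t) = e (act h t)"
    and act_less: "h \<in> Arr C \<Longrightarrow> (s, t) \<in> less (Dom C h) \<Longrightarrow> (act h s, act h t) \<in> less (Cod C h)"
    and good_pair: "\<And>(z :: nat \<Rightarrow> 'o) t. (\<And>i. z i \<in> Obj C \<and> t i \<in> T (z i)) \<Longrightarrow>
      \<exists>i j. i < j \<and> (\<exists>h\<in>hom_set C (z i) (z j). t j = act h (t i))"
    and C: "category C"
begin

abbreviation "below z t \<equiv> lspan R (rep_obj F z) (e ` {s. (s, t) \<in> less z})"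

text \<open>The left ideal of leading coefficients at \<open>t\<close> of those elements of \<open>N z\<close> that can be written with
  leading term \<open>t\<close>. As the generators may satisfy relations, an element can have several leading
  terms.\<close>

definition initial :: "('o \<Rightarrow> 'v set) \<Rightarrow> 'o \<Rightarrow> 't \<Rightarrow> 'k set" where
  "initial N z t = {c \<in> carrier R. \<exists>u \<in> below z t. c \<odot>\<^bsub>rep_obj F z\<^esub> e t \<oplus>\<^bsub>rep_obj F z\<^esub> u \<in> N z}"

lemma module_at: "z \<in> Obj C \<Longrightarrow> left_module R (rep_obj F z)"
  using rep by (simp add: representation_def)

lemma below_carrier: "z \<in> Obj C \<Longrightarrow> e ` {s. (s, t) \<in> less z} \<subseteq> carrier (rep_obj F z)"
  using e_in less_in by blast

lemma initial_left_ideal: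
  assumes N: "subrep R C F N" and z: "z \<in> Obj C" and t: "t \<in> T z"
  shows "left_ideal R (initial N z t)"
proof -
  let ?M = "rep_obj F z"
  interpret left_module R ?M by (rule module_at[OF z])
  have sub: "submodule (N z) R ?M" using N z by (simp add: subrep_def)
  note [simp] = e_in[OF z t] lsmult_closed
  note S = below_carrier[OF z, of t]
  have bc: "u \<in> carrier ?M" if "u \<in> below z t" for u using that lspan_subset[OF S] by blast
  have add: "x \<oplus>\<^bsub>R\<^esub> y \<in> initial N z t" if xy: "x \<in> initial N z t" "y \<in> initial N z t" for x y
  proof -
    obtain u v where u: "x \<in> carrier R" "u \<in> below z t" "x \<odot>\<^bsub>?M\<^esub> e t \<oplus>\<^bsub>?M\<^esub> u \<in> N z"
      and v: "y \<in> carrier R" "v \<in> below z t" "y \<odot>\<^bsub>?M\<^esub> e t \<oplus>\<^bsub>?M\<^esub> v \<in> N z"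
      using xy by (auto simp: initial_def)
    have "(x \<oplus>\<^bsub>R\<^esub> y) \<odot>\<^bsub>?M\<^esub> e t \<oplus>\<^bsub>?M\<^esub> (u \<oplus>\<^bsub>?M\<^esub> v) =
        (x \<odot>\<^bsub>?M\<^esub> e t \<oplus>\<^bsub>?M\<^esub> u) \<oplus>\<^bsub>?M\<^esub> (y \<odot>\<^bsub>?M\<^esub> e t \<oplus>\<^bsub>?M\<^esub> v)"
      using u v bc by (simp add: lsmult_l_distr M.add.m_ac)
    then show ?thesis
      using u v submodule_facts(3)[OF sub] lspan_add[OF S] unfolding initial_def
      by (metis (mono_tags, lifting) R.a_closed mem_Collect_eq)
  qed
  have smult: "a \<otimes>\<^bsub>R\<^esub> x \<in> initial N z t" if a: "a \<in> carrier R" and x: "x \<in> initial N z t" for a x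
  proof -
    obtain u where u: "x \<in> carrier R" "u \<in> below z t" "x \<odot>\<^bsub>?M\<^esub> e t \<oplus>\<^bsub>?M\<^esub> u \<in> N z"
      using x by (auto simp: initial_def)
    have "(a \<otimes>\<^bsub>R\<^esub> x) \<odot>\<^bsub>?M\<^esub> e t \<oplus>\<^bsub>?M\<^esub> a \<odot>\<^bsub>?M\<^esub> u = a \<odot>\<^bsub>?M\<^esub> (x \<odot>\<^bsub>?M\<^esub> e t \<oplus>\<^bsub>?M\<^esub> u)"
      using u a bc by (simp add: lsmult_r_distr lsmult_assoc)
    then show ?thesis
      using u a submodule_facts(5)[OF sub] lspan_smult[OF S] unfolding initial_def
      by (metis (mono_tags, lifting) R.m_closed mem_Collect_eq)
  qed
  have zero: "\<zero>\<^bsub>R\<^esub> \<in> initial N z t"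
    using submodule_facts(2)[OF sub] lspan.zero
    by (auto simp: initial_def lsmult_zero_left intro!: bexI[of _ "\<zero>\<^bsub>?M\<^esub>"])
  have car: "initial N z t \<subseteq> carrier R" by (auto simp: initial_def)
  have "\<ominus>\<^bsub>R\<^esub> x \<in> initial N z t" if "x \<in> initial N z t" for x
    using smult[of "\<ominus>\<^bsub>R\<^esub> \<one>\<^bsub>R\<^esub>" x] that car by (auto simp: R.l_minus)
  then show ?thesis
    unfolding left_ideal_def additive_subgroup_def
    by (auto intro!: subgroup.intro simp: add zero smult simp flip: a_inv_def) (use car in auto)
qed

lemma initial_mono: "N z \<subseteq> N' z \<Longrightarrow> initial N z t \<subseteq> initial N' z t"
  by (auto simp: initial_def)

text \<open>An arrow \<open>h\<close> moves the leading term \<open>t\<close> to \<open>act h t\<close> and, being strictly monotone on terms, keeps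
  the lower terms below it.\<close>

lemma initial_act:
  assumes N: "subrep R C F N" and h: "h \<in> hom_set C y z" and t: "t \<in> T y"
  shows "initial N y t \<subseteq> initial N z (act h t)"
proof
  fix c assume "c \<in> initial N y t"
  let ?M = "rep_obj F y" and ?M' = "rep_obj F z"
  have y: "y \<in> Obj C" and z: "z \<in> Obj C" and hA: "h \<in> Arr C" "Dom C h = y" "Cod C h = z"
    using h category.Dom_in[OF C] category.Cod_in[OF C] by (auto simp: hom_set_def)
  interpret M: left_module R ?M by (rule module_at[OF y])
  have hom: "rep_map F h \<in> left_module_hom R ?M ?M'"
    using rep hA unfolding representation_def by blast
  obtain u where u: "c \<in> carrier R" "u \<in> below y t" "c \<odot>\<^bsub>?M\<^esub> e t \<oplus>\<^bsub>?M\<^esub> u \<in> N y"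
    using \<open>c \<in> initial N y t\<close> by (auto simp: initial_def)
  have "rep_map F h u \<in> lspan R ?M' (rep_map F h ` e ` {s. (s, t) \<in> less y})"
    by (rule left_module_hom_lspan[OF module_at[OF y] module_at[OF z] hom below_carrier[OF y] u(2)])
  moreover have "rep_map F h ` e ` {s. (s, t) \<in> less y} \<subseteq> e ` {s. (s, act h t) \<in> less z}"
  proof safe
    fix s assume s: "(s, t) \<in> less y"
    then have "s \<in> T y" using less_in[OF y] by blast
    then have "rep_map F h (e s) = e (act h s)" using rep_map_e hA by simp
    then show "rep_map F h (e s) \<in> e ` {s. (s, act h t) \<in> less z}"
      using act_less[OF hA(1), of s t] s hA by auto
  qed
  ultimately have hu: "rep_map F h u \<in> below z (act h t)" by (rule subsetD[OF lspan_mono, rotated])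
  have uc: "u \<in> carrier ?M" using M.lspan_subset[OF below_carrier[OF y]] u(2) by blast
  have "rep_map F h (c \<odot>\<^bsub>?M\<^esub> e t \<oplus>\<^bsub>?M\<^esub> u) \<in> N z"
    using N hA u(3) unfolding subrep_def by blast
  moreover have "rep_map F h (c \<odot>\<^bsub>?M\<^esub> e t \<oplus>\<^bsub>?M\<^esub> u) =
      c \<odot>\<^bsub>?M'\<^esub> rep_map F h (e t) \<oplus>\<^bsub>?M'\<^esub> rep_map F h u"
    using hom u(1) uc e_in[OF y t] M.lsmult_closed by (simp add: left_module_hom_def)
  ultimately show "c \<in> initial N z (act h t)"
    using hu u(1) rep_map_e[of h t] hA t by (auto simp: initial_def)
qed

text \<open>A nonzero combination involves finitely many terms, and the order is total, so there is a largest
  one.\<close>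

lemma lspan_leading_term:
  assumes z: "z \<in> Obj C" and U: "U \<subseteq> T z" and v: "v \<in> lspan R (rep_obj F z) (e ` U)"
  shows "v = \<zero>\<^bsub>rep_obj F z\<^esub> \<or>
    (\<exists>t\<in>U. v \<in> lspan R (rep_obj F z) (insert (e t) (e ` {s. (s, t) \<in> less z})))"
  using v
proof (induction rule: lspan.induct)
  case (step c x v)
  then obtain a where a: "a \<in> U" "x = e a" by blast
  let ?S = "\<lambda>t. insert (e t) (e ` {s. (s, t) \<in> less z})"
  have mono: "?S b \<subseteq> ?S b'" if "(b, b') \<in> less z" for b b'
    using that transD[OF less_trans[OF z]] by blast
  have bound: ?case if "b \<in> U" "x \<in> ?S b" "v \<in> lspan R (rep_obj F z) (?S b)" for b
    using that step(1) by (blast intro: lspan.step)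
  show ?case
  proof (cases "v = \<zero>\<^bsub>rep_obj F z\<^esub>")
    case True
    then show ?thesis using bound[of a] a by (auto intro: lspan.zero)
  next
    case False
    then obtain t where t: "t \<in> U" "v \<in> lspan R (rep_obj F z) (?S t)" using step by blast
    consider "t = a" | "(t, a) \<in> less z" | "(a, t) \<in> less z"
      using less_total[OF z] t(1) a(1) U unfolding total_on_def by blast
    then show ?thesis
    proof cases
      case 2
      then show ?thesis using bound[of a] a t lspan_mono[OF mono] by blast
    qed (use bound[of t] a t in auto)
  qed
qed simp

text \<open>Division with remainder. If \<open>v \<in> N' z\<close> has leading term \<open>t\<close> with coefficient \<open>c\<close>, then \<open>N z\<close> has
  an element with the same leading term and coefficient; their difference lies in \<open>N' z\<close> and below
  \<open>t\<close>, so it is in \<open>N z\<close> by well-founded induction.\<close>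

lemma subrep_eq_if_initial_eq:
  assumes N: "subrep R C F N" "subrep R C F N'" and z: "z \<in> Obj C" and "N z \<subseteq> N' z"
    and init: "\<And>t. t \<in> T z \<Longrightarrow> initial N' z t \<subseteq> initial N z t"
  shows "N' z = N z"
proof
  let ?M = "rep_obj F z"
  interpret left_module R ?M by (rule module_at[OF z])
  have sub: "submodule (N z) R ?M" "submodule (N' z) R ?M" using N z by (auto simp: subrep_def)
  have *: "\<forall>v \<in> lspan R ?M (insert (e t) (e ` {s. (s, t) \<in> less z})). t \<in> T z \<longrightarrow> v \<in> N' z \<longrightarrow> v \<in> N z" for t
  proof (induction t rule: wf_induct_rule[OF less_wf[OF z]])
    case (1 t)
    show ?case
    proof (intro ballI impI)
      fix v assume v: "v \<in> lspan R ?M (insert (e t) (e ` {s. (s, t) \<in> less z}))" "v \<in> N' z"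
        and t: "t \<in> T z"
      note S = below_carrier[OF z, of t]
      have et: "e t \<in> carrier ?M" by (rule e_in[OF z t])
      obtain c u where cu: "c \<in> carrier R" "u \<in> below z t" "v = c \<odot>\<^bsub>?M\<^esub> e t \<oplus>\<^bsub>?M\<^esub> u"
        using lspan_insertE[OF _ v(1)] S et by blast
      then have "c \<in> initial N' z t" using v(2) by (auto simp: initial_def)
      then obtain u' where u': "u' \<in> below z t" "c \<odot>\<^bsub>?M\<^esub> e t \<oplus>\<^bsub>?M\<^esub> u' \<in> N z"
        using init[OF t] by (auto simp: initial_def)
      let ?n = "c \<odot>\<^bsub>?M\<^esub> e t \<oplus>\<^bsub>?M\<^esub> u'"
      define d where "d = u \<oplus>\<^bsub>?M\<^esub> \<ominus>\<^bsub>?M\<^esub> u'"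
      have car: "u \<in> carrier ?M" "u' \<in> carrier ?M" "c \<odot>\<^bsub>?M\<^esub> e t \<in> carrier ?M"
        using lspan_subset[OF S] cu u' lsmult_closed et by auto
      have "?n \<oplus>\<^bsub>?M\<^esub> d = (c \<odot>\<^bsub>?M\<^esub> e t \<oplus>\<^bsub>?M\<^esub> u) \<oplus>\<^bsub>?M\<^esub> (u' \<oplus>\<^bsub>?M\<^esub> \<ominus>\<^bsub>?M\<^esub> u')"
        unfolding d_def using car by (simp add: M.a_ac)
      then have v_eq: "v = ?n \<oplus>\<^bsub>?M\<^esub> d" using car by (simp add: cu M.r_neg)
      then have d_eq: "d = v \<oplus>\<^bsub>?M\<^esub> \<ominus>\<^bsub>?M\<^esub> ?n"
        using car by (metis M.a_comm M.a_inv_closed M.a_closed M.r_neg1 d_def)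
      have d_below: "d \<in> below z t"
        unfolding d_def by (intro lspan_add[OF S] lspan_uminus[OF S] cu u')
      have "d \<in> N' z"
        unfolding d_eq using v(2) u'(2) \<open>N z \<subseteq> N' z\<close> submodule_facts[OF sub(2)] by blast
      have "d \<in> N z"
        using lspan_leading_term[OF z _ d_below]
      proof
        show "{s. (s, t) \<in> less z} \<subseteq> T z" using less_in[OF z] by blast
        assume "d = \<zero>\<^bsub>?M\<^esub>"
        then show ?thesis using submodule_facts(2)[OF sub(1)] by simp
      next
        assume "\<exists>s\<in>{s. (s, t) \<in> less z}. d \<in> lspan R ?M (insert (e s) (e ` {r. (r, s) \<in> less z}))"
        then show ?thesis using 1 \<open>d \<in> N' z\<close> less_in[OF z] by blast
      qed
      then show "v \<in> N z" unfolding v_eq using u'(2) submodule_facts(3)[OF sub(1)] by blast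
    qed
  qed
  show "N' z \<subseteq> N z"
  proof
    fix v assume v: "v \<in> N' z"
    then have "v \<in> lspan R ?M (e ` T z)" using submodule_facts(1)[OF sub(2)] span[OF z] by blast
    from lspan_leading_term[OF z order_refl this] show "v \<in> N z"
      using * v submodule_facts(2)[OF sub(1)] by blast
  qed
qed fact

text \<open>Suppose that leading ideals still grow at infinitely many steps, at the terms \<open>t\<close> chosen for
  them. Along a subsequence in which each of these terms divides the next, the ideals form a strictly
  ascending chain in \<open>R\<close>: each is enlarged at its own step and then mapped into the next by
  \<open>initial_act\<close>. The point is that one bound serves all objects and terms at once.\<close>

lemma initial_stabilizes:
  assumes N: "\<And>n. subrep R C F (N n)" and asc: "\<And>n z. z \<in> Obj C \<Longrightarrow> N n z \<subseteq> N (Suc n) z"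
  shows "\<exists>n. \<forall>m\<ge>n. \<forall>z\<in>Obj C. \<forall>t\<in>T z. initial (N m) z t = initial (N n) z t"
proof -
  have mono: "initial (N n) z t \<subseteq> initial (N m) z t" if "z \<in> Obj C" "n \<le> m" for n m z t
    using lift_Suc_mono_le[of "\<lambda>n. N n z" n m] asc that initial_mono by blast
  define K where "K = {n. \<exists>z\<in>Obj C. \<exists>t\<in>T z. initial (N n) z t \<noteq> initial (N (Suc n)) z t}"
  have "finite K"
  proof (rule ccontr)
    assume "infinite K"
    have "\<exists>x. n \<in> K \<longrightarrow> fst x \<in> Obj C \<and> snd x \<in> T (fst x) \<and>
        initial (N n) (fst x) (snd x) \<noteq> initial (N (Suc n)) (fst x) (snd x)" for n
      by (auto simp: K_def)
    then obtain x where x: "\<And>n. n \<in> K \<Longrightarrow> fst (x n) \<in> Obj C \<and> snd (x n) \<in> T (fst (x n)) \<and>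
        initial (N n) (fst (x n)) (snd (x n)) \<noteq> initial (N (Suc n)) (fst (x n)) (snd (x n))"
      by metis
    let ?A = "{(z, t). z \<in> Obj C \<and> t \<in> T z}"
    let ?Q = "\<lambda>a b. \<exists>h\<in>hom_set C (fst a) (fst b). snd b = act h (snd a)"
    have "\<exists>i j. i < j \<and> ?Q (s i) (s j)" if "range s \<subseteq> ?A" for s :: "nat \<Rightarrow> _"
    proof (rule good_pair)
      show "fst (s i) \<in> Obj C \<and> snd (s i) \<in> T (fst (s i))" for i
        using subsetD[OF that rangeI[of s i]] by (simp add: split_beta)
    qed
    moreover have k_in: "enumerate K i \<in> K" for i by (rule enumerate_in_set) fact
    have "range (\<lambda>i. x (enumerate K i)) \<subseteq> ?A"
      using x[OF k_in] by (simp add: image_subset_iff split_beta)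
    ultimately have "\<exists>\<phi> :: nat \<Rightarrow> nat. \<forall>i. \<phi> i < \<phi> (Suc i) \<and>
        ?Q (x (enumerate K (\<phi> i))) (x (enumerate K (\<phi> (Suc i))))"
      by (rule ascending_subsequence[where s = "\<lambda>i. x (enumerate K i)" and Q = ?Q and A = ?A])
    then obtain \<phi> where \<phi>: "\<And>i. \<phi> i < \<phi> (Suc i)"
        "\<And>i. ?Q (x (enumerate K (\<phi> i))) (x (enumerate K (\<phi> (Suc i))))"
      by auto
    define k where "k i = enumerate K (\<phi> i)" for i
    have kK: "k i \<in> K" for i using k_in by (simp add: k_def)
    have k_less: "k i < k (Suc i)" for i
      unfolding k_def by (rule enumerate_mono[OF \<phi>(1) \<open>infinite K\<close>])
    define J where "J i = initial (N (k i)) (fst (x (k i))) (snd (x (k i)))" for i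
    have strict: "J i \<subset> J (Suc i)" for i
    proof -
      let ?z = "fst (x (k i))" and ?t = "snd (x (k i))"
      have zt: "?z \<in> Obj C" "?t \<in> T ?z" using x[OF kK[of i]] by auto
      obtain h where h: "h \<in> hom_set C ?z (fst (x (k (Suc i))))" "snd (x (k (Suc i))) = act h ?t"
        using \<phi>(2)[of i] by (auto simp: k_def)
      have "J i \<subset> initial (N (Suc (k i))) ?z ?t"
        using x[OF kK[of i]] mono[OF zt(1), of "k i" "Suc (k i)" ?t] unfolding J_def by auto
      also have "\<dots> \<subseteq> initial (N (k (Suc i))) ?z ?t"
        using mono[OF zt(1)] k_less[of i] by simp
      also have "\<dots> \<subseteq> J (Suc i)"
        unfolding J_def h(2) by (rule initial_act[OF N h(1) zt(2)])
      finally show ?thesis .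
    qed
    have "\<forall>i. left_ideal R (J i)"
      unfolding J_def using initial_left_ideal[OF N] x[OF kK] by blast
    then obtain n where "\<forall>m\<ge>n. J m = J n"
      using left_noetherian strict unfolding left_noetherian_def by (metis psubset_imp_subset)
    then show False using strict[of n] by (metis le_SucI order_refl psubset_eq)
  qed
  then obtain b where b: "\<And>n. n \<in> K \<Longrightarrow> n < b" using finite_nat_set_iff_bounded by auto
  have "initial (N m) z t = initial (N b) z t" if "b \<le> m" "z \<in> Obj C" "t \<in> T z" for m z t
    using that(1)
  proof (induction rule: dec_induct)
    case (step n)
    then have "n \<notin> K" using b[of n] by auto
    then show ?case using that step unfolding K_def by auto
  qed simp
  then show ?thesis by blast
qed

theorem noetherian: "noetherian_rep R C F"
  unfolding noetherian_rep_def
proof (intro conjI allI impI rep)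
  fix N :: "nat \<Rightarrow> 'o \<Rightarrow> 'v set"
  assume "(\<forall>n. subrep R C F (N n)) \<and> (\<forall>n. \<forall>x\<in>Obj C. N n x \<subseteq> N (Suc n) x)"
  then have N: "\<And>n. subrep R C F (N n)" and asc: "\<And>n z. z \<in> Obj C \<Longrightarrow> N n z \<subseteq> N (Suc n) z"
    by auto
  obtain n where n: "\<And>m z t. n \<le> m \<Longrightarrow> z \<in> Obj C \<Longrightarrow> t \<in> T z \<Longrightarrow> initial (N m) z t = initial (N n) z t"
    using initial_stabilizes[of N, OF N asc] by blast
  have "N m z = N n z" if m: "n \<le> m" and z: "z \<in> Obj C" for m z
  proof (rule subrep_eq_if_initial_eq[OF N N z])
    show "N n z \<subseteq> N m z" by (rule lift_Suc_mono_le[of "\<lambda>n. N n z", OF asc[OF z] m])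
    show "initial (N m) z t \<subseteq> initial (N n) z t" if "t \<in> T z" for t
      using n[OF m z that] by simp
  qed
  then show "\<exists>n. \<forall>m\<ge>n. \<forall>x\<in>Obj C. N m x = N n x"
    by (intro exI[of _ n] allI impI ballI)
qed

end

section \<open>Representations of quasi-Groebner categories\<close>

text \<open>By the Yoneda lemma, a finite set \<open>B\<close> of generators at prescribed objects amounts to an
  epimorphism from a finite direct sum of principal projectives.\<close>

definition generates ::
    "('k, 'z) ring_scheme \<Rightarrow> ('o, 'm) cat \<Rightarrow> ('o, 'm, 'k, 'v) rep \<Rightarrow> ('o \<times> 'v) set \<Rightarrow> bool" where
  "generates R C F B \<longleftrightarrow> (\<forall>(x, v) \<in> B. x \<in> Obj C \<and> v \<in> carrier (rep_obj F x)) \<and>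
     (\<forall>z \<in> Obj C. carrier (rep_obj F z) \<subseteq>
        lspan R (rep_obj F z) {rep_map F f v | x v f. (x, v) \<in> B \<and> f \<in> hom_set C x z})"

text \<open>Representatives of the same class divide each other, so a good pair of classes gives a good pair of
  arrows.\<close>

lemma factor_preorder_good_pair:
  assumes G: "groebner C" and x: "x \<in> Obj C" and g: "\<And>i :: nat. g i \<in> arrows_from C x"
  shows "\<exists>i j. i < j \<and> (g i, g j) \<in> factor_preorder C x"
proof -
  have C: "category C" using G by (simp add: groebner_def)
  note eqv = equiv_factor_equiv[OF C x]
  let ?cls = "\<lambda>i. factor_equiv C x `` {g i}"
  have "?cls i \<in> poset_carrier C x" for i
    unfolding poset_carrier_def by (rule quotientI[OF g])
  then have "\<forall>i. ?cls i \<in> poset_carrier C x" by blast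
  moreover have "noetherian_poset (poset_carrier C x) (poset_le C x)"
    using G x by (simp add: groebner_def)
  ultimately have "\<exists>i j. i < j \<and> (?cls i, ?cls j) \<in> poset_le C x"
    unfolding noetherian_poset_def by (elim allE[of _ ?cls]) blast
  then obtain i j where "i < j" "(?cls i, ?cls j) \<in> poset_le C x" by blast
  then obtain a b where ab: "(g i, a) \<in> factor_equiv C x" "(g j, b) \<in> factor_equiv C x"
      "(a, b) \<in> factor_preorder C x"
    by (auto simp: poset_le_def)
  obtain u where u: "u \<in> hom_set C (Cod C (g i)) (Cod C a)" "a = Comp C u (g i)"
    using ab(1) by (auto simp: factor_equiv_def factor_preorder_def)
  obtain v where v: "v \<in> hom_set C (Cod C a) (Cod C b)" "b = Comp C v a"
    using ab(3) by (auto simp: factor_preorder_def)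
  obtain w where w: "w \<in> hom_set C (Cod C b) (Cod C (g j))" "g j = Comp C w b"
    using ab(2) by (auto simp: factor_equiv_def factor_preorder_def)
  interpret category C by fact
  have gi: "g i \<in> hom_set C x (Cod C (g i))" using g by (simp add: arrows_from_def hom_set_def)
  have vu: "Comp C v u \<in> hom_set C (Cod C (g i)) (Cod C b)" by (rule Comp_in[OF u(1) v(1)])
  have "b = Comp C (Comp C v u) (g i)" using Comp_assoc[OF gi u(1) v(1)] u(2) v(2) by simp
  then have "g j = Comp C (Comp C w (Comp C v u)) (g i)"
    using Comp_assoc[OF gi vu w(1)] w(2) by simp
  moreover have "Comp C w (Comp C v u) \<in> hom_set C (Cod C (g i)) (Cod C (g j))"
    by (rule Comp_in[OF vu w(1)])
  ultimately show ?thesis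
    using \<open>i < j\<close> g unfolding factor_preorder_def by blast
qed

text \<open>Terms are pairs of a generator and an arrow out of its object. They are compared first by an
  arbitrary numbering \<open>k\<close> of the finitely many generators and then by the given well-order on
  arrows; this is the usual order on terms in a finite direct sum of free modules.\<close>

theorem noetherian_rep_groebner:
  fixes C :: "('o, 'm) cat" and F :: "('o, 'm, 'k, 'v) rep"
  assumes G: "groebner C" and R: "left_noetherian R" and F: "representation R C F"
    and B: "finite B" "generates R C F B"
  shows "noetherian_rep R C F"
proof -
  have C: "category C" using G by (simp add: groebner_def)
  interpret category C by fact
  have B_in: "fst b \<in> Obj C" "snd b \<in> carrier (rep_obj F (fst b))" if "b \<in> B" for b
    using B(2) that by (auto simp: generates_def split_beta)
  obtain k :: "'o \<times> 'v \<Rightarrow> nat" where k: "inj_on k B"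
    using finite_imp_inj_to_nat_seg[OF B(1)] by blast
  have "\<exists>r. \<forall>y\<in>Obj C. well_order_on (hom_set C x y) (r y) \<and>
      (\<forall>z\<in>Obj C. \<forall>h\<in>hom_set C y z. \<forall>f g. (f, g) \<in> r y - Id \<longrightarrow> (Comp C h f, Comp C h g) \<in> r z - Id)"
    if "x \<in> Obj C" for x
    using G that unfolding groebner_def orderable_at_def by meson
  then obtain r where r: "\<And>x y. x \<in> Obj C \<Longrightarrow> y \<in> Obj C \<Longrightarrow> well_order_on (hom_set C x y) (r x y)"
    and r_mono: "\<And>x y z h f g. x \<in> Obj C \<Longrightarrow> y \<in> Obj C \<Longrightarrow> z \<in> Obj C \<Longrightarrow> h \<in> hom_set C y z \<Longrightarrow>
      (f, g) \<in> r x y - Id \<Longrightarrow> (Comp C h f, Comp C h g) \<in> r x z - Id"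
    by metis
  define T where "T z = {(b, f). b \<in> B \<and> f \<in> hom_set C (fst b) z}" for z
  define less where "less z = {((b, f), (b', f')). (b, f) \<in> T z \<and> (b', f') \<in> T z \<and>
    (k b < k b' \<or> b = b' \<and> (f, f') \<in> r (fst b) z - Id)}" for z
  define e where "e = (\<lambda>(b :: 'o \<times> 'v, f). rep_map F f (snd b))"
  define act where "act h = (\<lambda>(b :: 'o \<times> 'v, f). (b, Comp C h f))" for h
  have map_e: "rep_map F f (snd b) \<in> carrier (rep_obj F z)" if "b \<in> B" "f \<in> hom_set C (fst b) z" for b f z
  proof -
    have "rep_map F f \<in> left_module_hom R (rep_obj F (fst b)) (rep_obj F z)"
      using F that(2) by (auto simp: representation_def hom_set_def)
    then show ?thesis using B_in(2)[OF that(1)] by (auto simp: left_module_hom_def)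
  qed
  have r_in: "f \<in> hom_set C x z" "g \<in> hom_set C x z" if "(f, g) \<in> r x z" "x \<in> Obj C" "z \<in> Obj C" for f g x z
    using r[OF that(2,3)] that(1) by (auto simp: order_on_defs refl_on_def dest: well_order_on_domain)
  have "ordered_generators R C F T less e act"
  proof
    show "left_noetherian R" "representation R C F" by fact+
    fix z assume z: "z \<in> Obj C"
    show "less z \<subseteq> T z \<times> T z" by (auto simp: less_def)
    show "wf (less z)"
      unfolding wf_eq_minimal
    proof (intro allI impI)
      fix Q and t :: "('o \<times> 'v) \<times> 'm" assume "t \<in> Q"
      show "\<exists>t\<in>Q. \<forall>s. (s, t) \<in> less z \<longrightarrow> s \<notin> Q"
      proof (cases "Q \<inter> T z = {}")
        case True
        then show ?thesis using \<open>t \<in> Q\<close> by (intro bexI[of _ t]) (auto simp: less_def)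
      next
        case False
        then obtain t0 where t0: "t0 \<in> Q \<inter> T z" "\<And>s. s \<in> Q \<inter> T z \<Longrightarrow> k (fst t0) \<le> k (fst s)"
          using ex_has_least_nat[of "\<lambda>t. t \<in> Q \<inter> T z" _ "\<lambda>t. k (fst t)"] by blast
        define b where "b = fst t0"
        have b: "b \<in> B" using t0(1) by (auto simp: T_def b_def)
        let ?Q = "{f \<in> hom_set C (fst b) z. (b, f) \<in> Q}"
        have "wf (r (fst b) z - Id)" using r[OF B_in(1)[OF b] z] by (simp add: well_order_on_def)
        moreover have "snd t0 \<in> ?Q" using t0(1) by (auto simp: T_def b_def)
        ultimately obtain f where f: "f \<in> ?Q" "\<And>g. (g, f) \<in> r (fst b) z - Id \<Longrightarrow> g \<notin> ?Q"
          by (rule wfE_min) blast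
        have "s \<notin> Q" if s: "(s, (b, f)) \<in> less z" for s
        proof
          assume "s \<in> Q"
          then have "k b \<le> k (fst s)" using t0(2)[of s] s by (auto simp: less_def b_def)
          then show False using s f(2) \<open>s \<in> Q\<close> by (auto simp: less_def T_def)
        qed
        then show ?thesis using f(1) by blast
      qed
    qed
    show "trans (less z)"
    proof (rule transI)
      fix s t u assume "(s, t) \<in> less z" "(t, u) \<in> less z"
      moreover have "trans (r x z - Id)" if "x \<in> Obj C" for x
        using r[OF that z] by (auto simp: order_on_defs intro: trans_diff_Id)
      ultimately show "(s, u) \<in> less z"
        using B_in(1) unfolding less_def T_def by (auto dest: transD)
    qed
    show "total_on (T z) (less z)"
    proof (rule total_onI)
      fix s t assume st: "s \<in> T z" "t \<in> T z" "s \<noteq> t"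
      have "total_on (hom_set C (fst (fst s)) z) (r (fst (fst s)) z)"
        using r[OF B_in(1) z] st(1) by (auto simp: order_on_defs T_def)
      then show "(s, t) \<in> less z \<or> (t, s) \<in> less z"
        using st inj_onD[OF k, of "fst s" "fst t"] unfolding less_def T_def total_on_def
        by (cases "k (fst s)" "k (fst t)" rule: linorder_cases) (auto, blast)
    qed
    show "e t \<in> carrier (rep_obj F z)" if "t \<in> T z" for t
      using map_e that by (auto simp: T_def e_def)
    have gens: "{rep_map F f v | x v f. (x, v) \<in> B \<and> f \<in> hom_set C x z} = e ` T z"
      by (force simp: e_def T_def image_iff)
    show "carrier (rep_obj F z) \<subseteq> lspan R (rep_obj F z) (e ` T z)"
      using B(2) z unfolding generates_def gens[symmetric] by simp
  next
    fix h assume h: "h \<in> Arr C"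
    have hh: "h \<in> hom_set C (Dom C h) (Cod C h)" using h by (simp add: hom_set_def)
    show "rep_map F h (e t) = e (act h t)" if "t \<in> T (Dom C h)" for t
      using that h F B_in by (auto simp: T_def e_def act_def hom_set_def representation_def)
    fix s t assume "(s, t) \<in> less (Dom C h)"
    then show "(act h s, act h t) \<in> less (Cod C h)"
      using r_mono[OF _ Dom_in[OF h] Cod_in[OF h] hh] Comp_in[OF _ hh] B_in(1)
      unfolding less_def T_def act_def by auto blast+
  next
    \<comment> \<open>a good pair of terms: by the pigeonhole principle infinitely many terms have the same generator\<close>
    fix z :: "nat \<Rightarrow> 'o" and t assume zt: "\<And>i. z i \<in> Obj C \<and> t i \<in> T (z i)"
    have tz: "fst (t i) \<in> B" "snd (t i) \<in> hom_set C (fst (fst (t i))) (z i)" for i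
      using zt[of i] by (auto simp: T_def)
    then have "range (\<lambda>i. fst (t i)) \<subseteq> B" by (simp add: image_subset_iff)
    then have "finite (range (\<lambda>i. fst (t i)))" using B(1) finite_subset by blast
    then obtain a where "infinite {i \<in> UNIV. fst (t i) = fst (t a)}"
      using pigeonhole_infinite[OF infinite_UNIV_nat] by blast
    then have inf: "infinite {i. fst (t i) = fst (t a)}" by simp
    let ?\<phi> = "enumerate {i. fst (t i) = fst (t a)}"
    have \<phi>: "fst (t (?\<phi> i)) = fst (t a)" for i using enumerate_in_set[OF inf, of i] by simp
    let ?x = "fst (fst (t a))"
    have hom: "snd (t (?\<phi> i)) \<in> hom_set C ?x (z (?\<phi> i))" for i
      using tz(2)[of "?\<phi> i"] \<phi>[of i] by simp
    then have "snd (t (?\<phi> i)) \<in> arrows_from C ?x" for i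
      by (auto simp: arrows_from_def hom_set_def)
    then obtain i j where ij: "i < j" "(snd (t (?\<phi> i)), snd (t (?\<phi> j))) \<in> factor_preorder C ?x"
      using factor_preorder_good_pair[OF G B_in(1)[OF tz(1)[of a]], of "\<lambda>i. snd (t (?\<phi> i))"] by blast
    then obtain h where "h \<in> hom_set C (z (?\<phi> i)) (z (?\<phi> j))"
        "snd (t (?\<phi> j)) = Comp C h (snd (t (?\<phi> i)))"
      using hom[of i] hom[of j] by (auto simp: factor_preorder_def hom_set_def)
    then show "\<exists>i j. i < j \<and> (\<exists>h\<in>hom_set C (z i) (z j). t j = act h (t i))"
      using enumerate_mono[OF ij(1) inf] \<phi>[of i] \<phi>[of j]
      by (intro exI[of _ "?\<phi> i"] exI[of _ "?\<phi> j"]) (auto simp: act_def split_beta prod_eq_iff)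
  qed
  then show ?thesis by (rule ordered_generators.noetherian)
qed

text \<open>The unit vectors \<open>\<delta> n i f\<close> span the direct sum of free modules: induct on the number of nonzero
  coordinates, removing one at a time.\<close>

lemma direct_sum_lspan:
  fixes R :: "('k, 'z) ring_scheme" and X :: "nat \<Rightarrow> 'b set"
  assumes R: "ring R"
  defines "\<delta> \<equiv> \<lambda>n i f. \<lambda>j\<in>{..<n}. (\<lambda>g. if j = i \<and> g = f then \<one>\<^bsub>R\<^esub> else \<zero>\<^bsub>R\<^esub>)"
  defines "M \<equiv> \<lambda>n. direct_sum_module n (\<lambda>i. free_left_module R (X i))"
  assumes u: "u \<in> carrier (M n)"
  shows "u \<in> lspan R (M n) {\<delta> n i f | i f. i < n \<and> f \<in> X i}"
proof -
  interpret ring R by fact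
  define supp where "supp u = (SIGMA i:{..<n}. {f. u i f \<noteq> \<zero>\<^bsub>R\<^esub>})" for u :: "nat \<Rightarrow> 'b \<Rightarrow> 'k"
  have fin: "finite (supp u)" if "u \<in> carrier (M n)" for u
    using that unfolding supp_def M_def direct_sum_module_def free_left_module_def
    by (intro finite_SigmaI) (auto simp: PiE_iff)
  show ?thesis
    using u
  proof (induction "card (supp u)" arbitrary: u)
    case 0
    then have "supp u = {}" using fin by auto
    then have "u = \<zero>\<^bsub>M n\<^esub>"
      using 0 by (auto simp: supp_def M_def direct_sum_module_def free_left_module_def fun_eq_iff
        PiE_iff extensional_def)
    then show ?case by (simp add: lspan.zero)
  next
    case (Suc m)
    then obtain i f where supp_if: "(i, f) \<in> supp u" by (metis card.empty equals0I nat.distinct(1) surj_pair)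
    define v where "v = u(i := (u i)(f := \<zero>\<^bsub>R\<^esub>))"
    have i: "i < n" using supp_if by (simp add: supp_def)
    have uR: "u j g \<in> carrier R" if "j < n" for j g
      using Suc.prems that by (auto simp: M_def direct_sum_module_def free_left_module_def PiE_iff)
    have f: "f \<in> X i" using supp_if Suc.prems
      by (auto simp: supp_def M_def direct_sum_module_def free_left_module_def PiE_iff)
    have "supp v = supp u - {(i, f)}" using i by (auto simp: supp_def v_def split: if_splits)
    then have "card (supp v) = m" using supp_if Suc.hyps(2) fin[OF Suc.prems] by simp
    moreover have v: "v \<in> carrier (M n)"
    proof -
      have "finite {g. g \<noteq> f \<and> u i g \<noteq> \<zero>\<^bsub>R\<^esub>}" 
        using Suc.prems i by (auto simp: M_def direct_sum_module_def free_left_module_def PiE_iff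
          intro: rev_finite_subset)
      then show ?thesis
        using Suc.prems i unfolding M_def direct_sum_module_def free_left_module_def v_def
        by (auto simp: PiE_iff extensional_def cong: conj_cong)
    qed
    ultimately have "v \<in> lspan R (M n) {\<delta> n i f | i f. i < n \<and> f \<in> X i}" using Suc.hyps(1) by blast
    then have "u i f \<odot>\<^bsub>M n\<^esub> \<delta> n i f \<oplus>\<^bsub>M n\<^esub> v \<in> lspan R (M n) {\<delta> n i f | i f. i < n \<and> f \<in> X i}"
      using uR[OF i] i f by (intro lspan.step) auto
    also have "u i f \<odot>\<^bsub>M n\<^esub> \<delta> n i f \<oplus>\<^bsub>M n\<^esub> v = u"
    proof (intro ext)
      fix j g
      have "u j = undefined" if "\<not> j < n"
        using that Suc.prems by (auto simp: M_def direct_sum_module_def PiE_iff extensional_def)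
      then show "(u i f \<odot>\<^bsub>M n\<^esub> \<delta> n i f \<oplus>\<^bsub>M n\<^esub> v) j g = u j g"
        using uR i by (auto simp: M_def direct_sum_module_def free_left_module_def \<delta>_def v_def)
    qed
    finally show ?case .
  qed
qed

text \<open>The generators are the images of the identities, by the Yoneda description of maps out of principal
  projectives.\<close>

lemma fin_gen_rep_generates:
  fixes F :: "('o, 'm, 'k, 'v) rep"
  assumes R: "ring R" and C: "category C" and F: "fin_gen_rep R C F"
  obtains B where "finite B" "generates R C F B"
proof -
  interpret ring R by fact
  interpret category C by fact
  obtain n x where x: "\<And>i. i < n \<Longrightarrow> x i \<in> Obj C"
    and quot: "is_quotient R C (direct_sum_rep n (\<lambda>i. principal_projective R C (x i))) F"
    using F by (auto simp: fin_gen_rep_def)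
  obtain \<eta> where \<eta>: "nat_trans R C (direct_sum_rep n (\<lambda>i. principal_projective R C (x i))) F \<eta>"
    and onto: "\<And>z. z \<in> Obj C \<Longrightarrow>
      \<eta> z ` carrier (rep_obj (direct_sum_rep n (\<lambda>i. principal_projective R C (x i))) z) = carrier (rep_obj F z)"
    using quot by (auto simp: is_quotient_def)
  have F': "representation R C F" using F by (simp add: fin_gen_rep_def)
  let ?P = "direct_sum_rep n (\<lambda>i. principal_projective R C (x i))"
  define \<delta> where "\<delta> i f = (\<lambda>j\<in>{..<n}. (\<lambda>g. if j = i \<and> g = f then \<one>\<^bsub>R\<^esub> else \<zero>\<^bsub>R\<^esub>))" for i and f :: 'm
  have obj: "rep_obj ?P z = direct_sum_module n (\<lambda>i. free_left_module R (hom_set C (x i) z))" for z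
    by (simp add: direct_sum_rep_def principal_projective_def)
  have mod: "left_module R (rep_obj ?P z)" for z
    unfolding obj by (intro left_module_direct_sum_module[OF R] left_module_free_left_module[OF R])
  have \<delta>_in: "\<delta> i f \<in> carrier (rep_obj ?P z)" if "i < n" "f \<in> hom_set C (x i) z" for i f z
  proof -
    have "finite {g. j = i \<and> g = f}" for j by (rule finite_subset[of _ "{f}"]) auto
    then show ?thesis
      using that unfolding obj \<delta>_def direct_sum_module_def free_left_module_def
      by (auto simp: PiE_iff cong: conj_cong)
  qed
  have \<delta>_map: "rep_map ?P f (\<delta> i (Ident C (x i))) = \<delta> i f" if i: "i < n" and f: "f \<in> hom_set C (x i) z" for i f z
  proof
    fix j
    show "rep_map ?P f (\<delta> i (Ident C (x i))) j = \<delta> i f j"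
    proof (cases "j < n")
      case True
      let ?a = "\<lambda>g. if j = i \<and> g = Ident C (x i) then \<one>\<^bsub>R\<^esub> else \<zero>\<^bsub>R\<^esub>"
      have fin: "finite {g. j = i \<and> g = Ident C (x i)}" by (rule finite_subset[of _ "{Ident C (x i)}"]) auto
      have a: "?a \<in> carrier (free_left_module R (hom_set C (x j) (x i)))"
        using Ident_in[OF x[OF i]] fin by (auto simp: free_left_module_def cong: conj_cong)
      have "rep_map (principal_projective R C (x j)) f ?a g =
          (\<Oplus>\<^bsub>R\<^esub>h \<in> {Ident C (x i)}. if Comp C f h = g then ?a h else \<zero>\<^bsub>R\<^esub>)" for g
        by (rule rep_map_principal_projective[OF R C f a]) auto
      then have "rep_map (principal_projective R C (x j)) f ?a = (\<lambda>g. if j = i \<and> g = f then \<one>\<^bsub>R\<^esub> else \<zero>\<^bsub>R\<^esub>)"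
        using Comp_Ident_right[OF f] by (auto simp: fun_eq_iff)
      then show ?thesis using True by (simp add: direct_sum_rep_def \<delta>_def)
    qed (simp add: direct_sum_rep_def \<delta>_def)
  qed
  define B where "B = (\<lambda>i. (x i, \<eta> (x i) (\<delta> i (Ident C (x i))))) ` {..<n}"
  have \<eta>_hom: "\<eta> z \<in> left_module_hom R (rep_obj ?P z) (rep_obj F z)" if "z \<in> Obj C" for z
    using \<eta> that by (simp add: nat_trans_def)
  have \<eta>_in: "\<eta> z u \<in> carrier (rep_obj F z)" if "z \<in> Obj C" "u \<in> carrier (rep_obj ?P z)" for z u
    using \<eta>_hom[OF that(1)] that(2) by (auto simp: left_module_hom_def)
  have \<delta>_id: "\<delta> i (Ident C (x i)) \<in> carrier (rep_obj ?P (x i))" if "i < n" for i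
    by (rule \<delta>_in[OF that Ident_in[OF x[OF that]]])
  show thesis
  proof (rule that)
    show "finite B" by (simp add: B_def)
    show "generates R C F B"
      unfolding generates_def
    proof (intro conjI ballI)
      fix b assume "b \<in> B"
      then show "case b of (x, v) \<Rightarrow> x \<in> Obj C \<and> v \<in> carrier (rep_obj F x)"
        using x \<eta>_in[OF x \<delta>_id] by (auto simp: B_def)
    next
      fix z assume z: "z \<in> Obj C"
      let ?S = "{\<delta> i f | i f. i < n \<and> f \<in> hom_set C (x i) z}"
      show "carrier (rep_obj F z) \<subseteq>
          lspan R (rep_obj F z) {rep_map F f v | x v f. (x, v) \<in> B \<and> f \<in> hom_set C x z}"
      proof
        fix v assume "v \<in> carrier (rep_obj F z)"
        then obtain u where u: "u \<in> carrier (rep_obj ?P z)" "v = \<eta> z u" using onto[OF z] by blast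
        have "u \<in> lspan R (rep_obj ?P z) ?S"
          using direct_sum_lspan[OF R, where n = n and X = "\<lambda>i. hom_set C (x i) z" and u = u] u(1)
          unfolding obj \<delta>_def by simp
        moreover have "?S \<subseteq> carrier (rep_obj ?P z)" using \<delta>_in by blast
        moreover have "left_module R (rep_obj F z)" using F' z by (simp add: representation_def)
        ultimately have "v \<in> lspan R (rep_obj F z) (\<eta> z ` ?S)"
          using left_module_hom_lspan[OF mod _ \<eta>_hom[OF z]] u(2) by blast
        moreover have "\<eta> z ` ?S \<subseteq> {rep_map F f v | x v f. (x, v) \<in> B \<and> f \<in> hom_set C x z}"
        proof safe
          fix i f assume i: "i < n" and f: "f \<in> hom_set C (x i) z"
          have "\<eta> (Cod C f) (rep_map ?P f (\<delta> i (Ident C (x i)))) = rep_map F f (\<eta> (Dom C f) (\<delta> i (Ident C (x i))))"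
            using \<eta> f \<delta>_id[OF i] unfolding nat_trans_def hom_set_def by auto
          then have "\<eta> z (\<delta> i f) = rep_map F f (\<eta> (x i) (\<delta> i (Ident C (x i))))"
            using \<delta>_map[OF i f] f by (simp add: hom_set_def)
          then show "\<exists>x' v f'. \<eta> z (\<delta> i f) = rep_map F f' v \<and> (x', v) \<in> B \<and> f' \<in> hom_set C x' z"
            using i f by (auto simp: B_def)
        qed
        ultimately show "v \<in> lspan R (rep_obj F z) {rep_map F f v | x v f. (x, v) \<in> B \<and> f \<in> hom_set C x z}"
          by (rule subsetD[OF lspan_mono, rotated])
      qed
    qed
  qed
qed

definition pullback_rep :: "('p, 'n, 'o, 'm) func \<Rightarrow> ('o, 'm, 'k, 'v) rep \<Rightarrow> ('p, 'n, 'k, 'v) rep" where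
  "pullback_rep \<Phi> F = \<lparr>rep_obj = (\<lambda>x. rep_obj F (on_obj \<Phi> x)), rep_map = (\<lambda>f. rep_map F (on_arr \<Phi> f))\<rparr>"

lemma representation_pullback_rep:
  assumes \<Phi>: "is_functor C' C \<Phi>" and C': "category C'" and F: "representation R C F"
  shows "representation R C' (pullback_rep \<Phi> F)"
proof -
  interpret category C' by fact
  have arr: "on_arr \<Phi> f \<in> Arr C" "Dom C (on_arr \<Phi> f) = on_obj \<Phi> (Dom C' f)"
      "Cod C (on_arr \<Phi> f) = on_obj \<Phi> (Cod C' f)" if "f \<in> Arr C'" for f
    using \<Phi> that by (auto simp: is_functor_def hom_set_def)
  have hom: "rep_map F (on_arr \<Phi> f) \<in>
      left_module_hom R (rep_obj F (on_obj \<Phi> (Dom C' f))) (rep_obj F (on_obj \<Phi> (Cod C' f)))"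
    if "f \<in> Arr C'" for f
    using F arr[OF that] unfolding representation_def by metis
  have comp: "rep_map F (on_arr \<Phi> (Comp C' g f)) v = rep_map F (on_arr \<Phi> g) (rep_map F (on_arr \<Phi> f) v)"
    if "f \<in> Arr C'" "g \<in> Arr C'" "Cod C' f = Dom C' g" "v \<in> carrier (rep_obj F (on_obj \<Phi> (Dom C' f)))"
    for f g v
    using F \<Phi> that arr[OF that(1)] arr[OF that(2)] unfolding representation_def is_functor_def by simp
  show ?thesis
    using F \<Phi> hom comp unfolding representation_def[of R C'] pullback_rep_def
    by (auto simp: representation_def is_functor_def)
qed

text \<open>This is what property (F) is for: an arrow from \<open>x\<close> to \<open>\<Phi> z\<close> factors through one of finitely many
  arrows \<open>f: x \<rightarrow> \<Phi> y\<close> by an arrow in the image of \<open>\<Phi>\<close>. Hence the elements \<open>F(f) v\<close>, for the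
  generators \<open>v\<close> of \<open>F\<close> at \<open>x\<close>, generate the pullback.\<close>

lemma generates_pullback_rep:
  fixes F :: "('o, 'm, 'k, 'v) rep"
  assumes C: "category C" and \<Phi>: "is_functor C' C \<Phi>" "property_F C' C \<Phi>"
    and F: "representation R C F" and B: "finite B" "generates R C F B"
  obtains B' where "finite B'" "generates R C' (pullback_rep \<Phi> F) B'"
proof -
  interpret category C by fact
  have B_in: "fst b \<in> Obj C" "snd b \<in> carrier (rep_obj F (fst b))" if "b \<in> B" for b
    using B(2) that by (auto simp: generates_def split_beta)
  define covers where "covers x Y \<longleftrightarrow>
      finite Y \<and> (\<forall>y f. (y, f) \<in> Y \<longrightarrow> y \<in> Obj C' \<and> f \<in> hom_set C x (on_obj \<Phi> y)) \<and>
      (\<forall>z \<in> Obj C'. \<forall>h \<in> hom_set C x (on_obj \<Phi> z).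
        \<exists>y f g. (y, f) \<in> Y \<and> g \<in> hom_set C' y z \<and> h = Comp C (on_arr \<Phi> g) f)" for x Y
  have "\<exists>Y. covers x Y" if "x \<in> Obj C" for x
  proof -
    have "\<exists>(n::nat) y f. (\<forall>i<n. y i \<in> Obj C' \<and> f i \<in> hom_set C x (on_obj \<Phi> (y i))) \<and>
        (\<forall>z \<in> Obj C'. \<forall>h \<in> hom_set C x (on_obj \<Phi> z).
          \<exists>i<n. \<exists>g \<in> hom_set C' (y i) z. h = Comp C (on_arr \<Phi> g) (f i))"
      using \<Phi>(2) that unfolding property_F_def by (rule bspec)
    then obtain n :: nat and y f where
      n: "\<forall>i<n. y i \<in> Obj C' \<and> f i \<in> hom_set C x (on_obj \<Phi> (y i))"
        "\<forall>z \<in> Obj C'. \<forall>h \<in> hom_set C x (on_obj \<Phi> z).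
          \<exists>i<n. \<exists>g \<in> hom_set C' (y i) z. h = Comp C (on_arr \<Phi> g) (f i)"
      by (elim exE conjE)
    have "covers x ((\<lambda>i. (y i, f i)) ` {..<n})"
      unfolding covers_def
    proof (intro conjI ballI)
      fix z h assume "z \<in> Obj C'" "h \<in> hom_set C x (on_obj \<Phi> z)"
      then have "\<exists>i<n. \<exists>g \<in> hom_set C' (y i) z. h = Comp C (on_arr \<Phi> g) (f i)"
        using n(2) by blast
      then obtain i g where "i < n" "g \<in> hom_set C' (y i) z" "h = Comp C (on_arr \<Phi> g) (f i)"
        by (elim exE conjE bexE)
      then show "\<exists>y' f' g. (y', f') \<in> (\<lambda>i. (y i, f i)) ` {..<n} \<and> g \<in> hom_set C' y' z \<and>
          h = Comp C (on_arr \<Phi> g) f'"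
        by (intro exI[of _ "y i"] exI[of _ "f i"] exI[of _ g]) simp
    qed (use n(1) in auto)
    then show ?thesis by blast
  qed
  then obtain Y where "\<And>x. x \<in> Obj C \<Longrightarrow> covers x (Y x)" by metis
  then have Y: "\<And>x. x \<in> Obj C \<Longrightarrow> finite (Y x)"
      "\<And>x y f. x \<in> Obj C \<Longrightarrow> (y, f) \<in> Y x \<Longrightarrow> y \<in> Obj C' \<and> f \<in> hom_set C x (on_obj \<Phi> y)"
      "\<And>x z h. x \<in> Obj C \<Longrightarrow> z \<in> Obj C' \<Longrightarrow> h \<in> hom_set C x (on_obj \<Phi> z) \<Longrightarrow>
        \<exists>y f g. (y, f) \<in> Y x \<and> g \<in> hom_set C' y z \<and> h = Comp C (on_arr \<Phi> g) f"
    unfolding covers_def by blast+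
  define B' where "B' = (\<Union>b\<in>B. (\<lambda>(y, f). (y, rep_map F f (snd b))) ` Y (fst b))"
  show thesis
  proof (rule that)
    show "finite B'" unfolding B'_def using B(1) Y(1) B_in(1) by blast
    show "generates R C' (pullback_rep \<Phi> F) B'"
      unfolding generates_def
    proof (intro conjI ballI)
      fix b' assume "b' \<in> B'"
      then obtain b y f where b: "b \<in> B" "(y, f) \<in> Y (fst b)" "b' = (y, rep_map F f (snd b))"
        by (auto simp: B'_def)
      have yf: "y \<in> Obj C'" "f \<in> hom_set C (fst b) (on_obj \<Phi> y)" using Y(2)[OF B_in(1)[OF b(1)] b(2)] by auto
      then have "rep_map F f \<in> left_module_hom R (rep_obj F (fst b)) (rep_obj F (on_obj \<Phi> y))"
        using F by (auto simp: representation_def hom_set_def)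
      then show "case b' of (x, v) \<Rightarrow> x \<in> Obj C' \<and> v \<in> carrier (rep_obj (pullback_rep \<Phi> F) x)"
        using B_in(2)[OF b(1)] b(3) yf(1) by (auto simp: pullback_rep_def left_module_hom_def)
    next
      fix z assume z: "z \<in> Obj C'"
      have "on_obj \<Phi> z \<in> Obj C" using \<Phi>(1) z by (simp add: is_functor_def)
      then have "carrier (rep_obj F (on_obj \<Phi> z)) \<subseteq> lspan R (rep_obj F (on_obj \<Phi> z))
          {rep_map F h v | x v h. (x, v) \<in> B \<and> h \<in> hom_set C x (on_obj \<Phi> z)}"
        using B(2) unfolding generates_def by blast
      also have "{rep_map F h v | x v h. (x, v) \<in> B \<and> h \<in> hom_set C x (on_obj \<Phi> z)} \<subseteq>
          {rep_map F (on_arr \<Phi> g) w | y w g. (y, w) \<in> B' \<and> g \<in> hom_set C' y z}"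
      proof safe
        fix x v h assume b: "(x, v) \<in> B" and h: "h \<in> hom_set C x (on_obj \<Phi> z)"
        have x: "x \<in> Obj C" "v \<in> carrier (rep_obj F x)" using B_in[OF b] by auto
        obtain y f g where yfg: "(y, f) \<in> Y x" "g \<in> hom_set C' y z" "h = Comp C (on_arr \<Phi> g) f"
          using Y(3)[OF x(1) z h] by blast
        have "f \<in> hom_set C x (on_obj \<Phi> y)" using Y(2)[OF x(1) yfg(1)] by blast
        moreover have "on_arr \<Phi> g \<in> hom_set C (on_obj \<Phi> y) (on_obj \<Phi> z)"
          using \<Phi>(1) yfg(2) by (auto simp: is_functor_def hom_set_def)
        ultimately have "rep_map F h v = rep_map F (on_arr \<Phi> g) (rep_map F f v)"
          using F x(2) unfolding yfg(3) by (auto simp: representation_def hom_set_def)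
        moreover have "(y, rep_map F f v) \<in> B'" using b yfg(1) by (force simp: B'_def)
        ultimately show "\<exists>y w g. rep_map F h v = rep_map F (on_arr \<Phi> g) w \<and> (y, w) \<in> B' \<and> g \<in> hom_set C' y z"
          using yfg(2) by blast
      qed
      then have "lspan R (rep_obj F (on_obj \<Phi> z))
          {rep_map F h v | x v h. (x, v) \<in> B \<and> h \<in> hom_set C x (on_obj \<Phi> z)} \<subseteq>
        lspan R (rep_obj F (on_obj \<Phi> z))
          {rep_map F (on_arr \<Phi> g) w | y w g. (y, w) \<in> B' \<and> g \<in> hom_set C' y z}"
        by (rule lspan_mono)
      finally show "carrier (rep_obj (pullback_rep \<Phi> F) z) \<subseteq> lspan R (rep_obj (pullback_rep \<Phi> F) z)
          {rep_map (pullback_rep \<Phi> F) f v | x v f. (x, v) \<in> B' \<and> f \<in> hom_set C' x z}"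
        by (simp add: pullback_rep_def)
    qed
  qed
qed

text \<open>A chain of subrepresentations of \<open>F\<close> pulls back to one of the pullback, which becomes stationary at
  all objects \<open>\<Phi> x\<close> at the same step. Every other object is isomorphic to one of these, and
  subrepresentations are carried along isomorphisms.\<close>

lemma noetherian_rep_if_pullback:
  assumes C: "category C" and \<Phi>: "is_functor C' C \<Phi>" "essentially_surjective C' C \<Phi>"
    and F: "representation R C F" and noeth: "noetherian_rep R C' (pullback_rep \<Phi> F)"
  shows "noetherian_rep R C F"
  unfolding noetherian_rep_def
proof (intro conjI allI impI F)
  fix N assume N: "(\<forall>n::nat. subrep R C F (N n)) \<and> (\<forall>n. \<forall>x\<in>Obj C. N n x \<subseteq> N (Suc n) x)"
  define N' where "N' n x = N n (on_obj \<Phi> x)" for n x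
  have obj: "on_obj \<Phi> x \<in> Obj C" if "x \<in> Obj C'" for x using \<Phi>(1) that by (simp add: is_functor_def)
  have arr: "on_arr \<Phi> f \<in> Arr C" "Dom C (on_arr \<Phi> f) = on_obj \<Phi> (Dom C' f)"
      "Cod C (on_arr \<Phi> f) = on_obj \<Phi> (Cod C' f)" if "f \<in> Arr C'" for f
    using \<Phi>(1) that by (auto simp: is_functor_def hom_set_def)
  have N_map: "rep_map F f ` N n x \<subseteq> N n y" if "f \<in> hom_set C x y" for f x y n
  proof -
    have "subrep R C F (N n)" using N by simp
    then show ?thesis using that unfolding subrep_def hom_set_def by blast
  qed
  have "subrep R C' (pullback_rep \<Phi> F) (N' n)" for n
    unfolding subrep_def
  proof (intro conjI ballI)
    show "submodule (N' n x) R (rep_obj (pullback_rep \<Phi> F) x)" if "x \<in> Obj C'" for x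
      using N obj[OF that] by (simp add: subrep_def pullback_rep_def N'_def)
    show "rep_map (pullback_rep \<Phi> F) f ` N' n (Dom C' f) \<subseteq> N' n (Cod C' f)" if "f \<in> Arr C'" for f
      using N_map[of "on_arr \<Phi> f"] arr[OF that] by (simp add: pullback_rep_def N'_def hom_set_def)
  qed
  moreover have "N' n x \<subseteq> N' (Suc n) x" if "x \<in> Obj C'" for n x
    using N obj[OF that] by (simp add: N'_def)
  ultimately obtain n where n: "\<And>m x. n \<le> m \<Longrightarrow> x \<in> Obj C' \<Longrightarrow> N' m x = N' n x"
    using noeth unfolding noetherian_rep_def by metis
  have "N m y \<subseteq> N n y" if m: "n \<le> m" and y: "y \<in> Obj C" for m y
  proof
    fix v assume v: "v \<in> N m y"
    obtain x f g where x: "x \<in> Obj C'" and f: "f \<in> hom_set C (on_obj \<Phi> x) y"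
      and g: "g \<in> hom_set C y (on_obj \<Phi> x)" and fg: "Comp C f g = Ident C y"
      using \<Phi>(2) y unfolding essentially_surjective_def isomorphic_def by blast
    have "submodule (N m y) R (rep_obj F y)" using N y by (simp add: subrep_def)
    then have vF: "v \<in> carrier (rep_obj F y)" using v submodule_facts(1) by blast
    have "rep_map F g v \<in> N' m x" using N_map[OF g] v by (auto simp: N'_def)
    then have "rep_map F g v \<in> N n (on_obj \<Phi> x)" using n[OF m x] by (simp add: N'_def)
    then have "rep_map F f (rep_map F g v) \<in> N n y" using N_map[OF f] by blast
    moreover have "rep_map F f (rep_map F g v) = rep_map F (Comp C f g) v"
      using F f g vF by (auto simp: representation_def hom_set_def)
    moreover have "rep_map F (Ident C y) v = v"
      using F y vF by (simp add: representation_def)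
    ultimately show "v \<in> N n y" using fg by simp
  qed
  moreover have "N n y \<subseteq> N m y" if "n \<le> m" "y \<in> Obj C" for m y
    using lift_Suc_mono_le[of "\<lambda>n. N n y" n m] N that by blast
  ultimately have "N m y = N n y" if "n \<le> m" "y \<in> Obj C" for m y
    using that by (simp add: subset_antisym)
  then show "\<exists>n. \<forall>m\<ge>n. \<forall>x\<in>Obj C. N m x = N n x"
    by (intro exI[of _ n] allI impI ballI)
qed

theorem quasi_groebner_imp_noetherian_Rep:
  fixes C :: "('o, 'm) cat" and R :: "('k, 'z) ring_scheme"
  assumes C: "quasi_groebner TYPE('p) TYPE('n) C" and R: "left_noetherian R"
  shows "noetherian_Rep TYPE('v) R C"
  unfolding noetherian_Rep_def
proof (intro allI impI)
  fix F :: "('o, 'm, 'k, 'v) rep" assume F: "fin_gen_rep R C F"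
  have cat: "category C" using C by (simp add: quasi_groebner_def)
  obtain C' :: "('p, 'n) cat" and \<Phi> where \<Phi>: "groebner C'" "is_functor C' C \<Phi>"
      "essentially_surjective C' C \<Phi>" "property_F C' C \<Phi>"
    using C unfolding quasi_groebner_def by blast
  have ring: "ring R" using R by (simp add: left_noetherian_def)
  have rep: "representation R C F" using F by (simp add: fin_gen_rep_def)
  have cat': "category C'" using \<Phi>(1) by (simp add: groebner_def)
  obtain B where B: "finite B" "generates R C F B" by (rule fin_gen_rep_generates[OF ring cat F])
  obtain B' where B': "finite B'" "generates R C' (pullback_rep \<Phi> F) B'"
    by (rule generates_pullback_rep[OF cat \<Phi>(2,4) rep B])
  show "noetherian_rep R C F"
    by (rule noetherian_rep_if_pullback[OF cat \<Phi>(2,3) rep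
      noetherian_rep_groebner[OF \<Phi>(1) R representation_pullback_rep[OF \<Phi>(2) cat' rep] B']])
qed

section \<open>The category of G-maps\<close>

text \<open>Copies of the finite ordinals inside the given infinite type, along an injection \<open>e\<close>.\<close>

definition segment :: "(nat \<Rightarrow> 'a) \<Rightarrow> nat \<Rightarrow> 'a set" where
  "segment e n = e ` {..<n}"

definition ordered_surj_map ::
    "('g, 'e) monoid_scheme \<Rightarrow> (nat \<Rightarrow> 'a) \<Rightarrow> nat \<Rightarrow> nat \<Rightarrow> (nat \<Rightarrow> nat) \<Rightarrow> ('a, 'g) gmap" where
  "ordered_surj_map G e m n h = GMap (segment e m) (segment e n)
     (\<lambda>x\<in>segment e m. e (h (the_inv e x))) (\<lambda>x\<in>segment e m. \<one>\<^bsub>G\<^esub>)"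

text \<open>The category of finite ordinals and ordered surjections, realized as a subcategory of \<open>FS G\<close> by
  giving all points the trivial weight.\<close>

definition OS ::
    "('g, 'e) monoid_scheme \<Rightarrow> (nat \<Rightarrow> 'a) \<Rightarrow> ('a set, ('a, 'g) gmap) cat" where
  "OS G e = (FS G)\<lparr>Obj := range (segment e), Arr := {ordered_surj_map G e m n h | m n h. ordered_surj m n h}\<rparr>"

lemma finite_hom_set_FS:
  assumes "finite (carrier G)" "finite R" "finite S"
  shows "finite (hom_set (FS G) R S)"
proof (rule finite_subset)
  show "hom_set (FS G) R S \<subseteq> (\<lambda>(f, \<rho>). GMap R S f \<rho>) ` ((R \<rightarrow>\<^sub>E S) \<times> (R \<rightarrow>\<^sub>E carrier G))"
    by (auto simp: hom_set_FS)
  show "finite \<dots>" using assms by (intro finite_imageI finite_cartesian_product finite_PiE) auto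
qed

lemma finite_linear_order_on_imp_well_order_on:
  assumes "finite A" "linear_order_on A r" shows "well_order_on A r"
proof -
  have *: "r \<subseteq> A \<times> A" "trans r" "antisym r"
    using assms(2) by (auto simp: order_on_defs refl_on_def)
  have "trans (r - Id)" using *(2,3) by (rule trans_diff_Id)
  then have "acyclic (r - Id)" by (simp add: acyclic_irrefl irrefl_def)
  moreover have "finite (r - Id)" using *(1) assms(1) by (meson finite_Diff finite_SigmaI finite_subset)
  ultimately show ?thesis using assms(2) finite_acyclic_wf by (simp add: well_order_on_def)
qed

locale segments = group G for G :: "('g, 'e) monoid_scheme" (structure) +
  fixes e :: "nat \<Rightarrow> 'a"
  assumes inj_e: "inj e" and finite_carrier: "finite (carrier G)"
begin

abbreviation "seg \<equiv> segment e"
abbreviation "arr \<equiv> ordered_surj_map G e"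
abbreviation "OSG \<equiv> OS G e"
abbreviation "FSG \<equiv> FS G :: ('a set, ('a, 'g) gmap) cat"

lemma the_inv_e [simp]: "the_inv e (e i) = i"
  using inj_e by (rule the_inv_f_f)

lemma e_in_seg [simp]: "e i \<in> seg n \<longleftrightarrow> i < n"
  using inj_e by (auto simp: segment_def dest: injD)

lemma seg_inj [simp]: "seg m = seg n \<longleftrightarrow> m = n"
proof
  assume "seg m = seg n"
  then have "card (e ` {..<m}) = card (e ` {..<n})" by (simp add: segment_def)
  moreover have "card (e ` {..<k}) = k" for k
    using card_image[of e "{..<k}"] inj_on_subset[OF inj_e] by simp
  ultimately show "m = n" by simp
qed simp

lemma arr_eq_iff: "arr m n h = arr m' n' h' \<longleftrightarrow> m = m' \<and> n = n' \<and> (\<forall>i<m. h i = h' i)"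
proof
  assume eq: "arr m n h = arr m' n' h'"
  then have mn: "m = m'" "n = n'" by (auto simp: ordered_surj_map_def)
  have "h i = h' i" if "i < m" for i
  proof -
    have "gfun (arr m n h) (e i) = gfun (arr m' n' h') (e i)" using eq by simp
    then have "e (h i) = e (h' i)" using that mn by (simp add: ordered_surj_map_def)
    then show ?thesis using inj_e by (simp add: inj_eq)
  qed
  then show "m = m' \<and> n = n' \<and> (\<forall>i<m. h i = h' i)" using mn by simp
next
  assume *: "m = m' \<and> n = n' \<and> (\<forall>i<m. h i = h' i)"
  then have "(\<lambda>x\<in>seg m. e (h (the_inv e x))) = (\<lambda>x\<in>seg m. e (h' (the_inv e x)))"
    by (intro restrict_ext) (auto simp: segment_def)
  then show "arr m n h = arr m' n' h'" using * by (simp add: ordered_surj_map_def)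
qed

lemma arr_hom_FS:
  assumes "ordered_surj m n h" shows "arr m n h \<in> hom_set FSG (seg m) (seg n)"
proof -
  have "(\<lambda>x\<in>seg m. e (h (the_inv e x))) ` seg m = e ` h ` {..<m}"
    unfolding segment_def image_image by (rule image_cong) auto
  then have "(\<lambda>x\<in>seg m. e (h (the_inv e x))) ` seg m = seg n"
    using assms by (simp add: ordered_surj_def segment_def)
  moreover have "(\<lambda>x\<in>seg m. e (h (the_inv e x))) \<in> seg m \<rightarrow>\<^sub>E seg n"
    using ordered_surj_lt[OF assms] by (auto simp: segment_def)
  moreover have "finite (seg m)" "finite (seg n)" by (auto simp: segment_def)
  ultimately show ?thesis unfolding hom_set_FS ordered_surj_map_def by auto
qed

lemma arr_comp:
  assumes "ordered_surj m n h"
  shows "Comp FSG (arr n p g) (arr m n h) = arr m p (\<lambda>i. g (h i))"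
proof -
  have "(\<lambda>x\<in>seg m. (\<lambda>x\<in>seg n. e (g (the_inv e x))) ((\<lambda>x\<in>seg m. e (h (the_inv e x))) x)) =
      (\<lambda>x\<in>seg m. e (g (h (the_inv e x))))"
    by (intro restrict_ext) (use ordered_surj_lt[OF assms] in \<open>auto simp: segment_def\<close>)
  moreover have "(\<lambda>x\<in>seg m. (\<lambda>x\<in>seg n. \<one>) ((\<lambda>x\<in>seg m. e (h (the_inv e x))) x) \<otimes> (\<lambda>x\<in>seg m. \<one>) x) =
      (\<lambda>x\<in>seg m. \<one>)"
    by (intro restrict_ext) (use ordered_surj_lt[OF assms] in \<open>auto simp: segment_def\<close>)
  ultimately show ?thesis by (simp only: FS_def ordered_surj_map_def cat.select_convs gmap.sel)
qed

lemma Ident_seg: "Ident FSG (seg n) = arr n n (\<lambda>i. i)"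
proof -
  have "(\<lambda>x\<in>seg n. x) = (\<lambda>x\<in>seg n. e (the_inv e x))"
    by (intro restrict_ext) (auto simp: segment_def)
  then show ?thesis by (simp add: FS_def ordered_surj_map_def)
qed

lemma OS_simps [simp]:
  "Obj OSG = range seg" "Arr OSG = {arr m n h | m n h. ordered_surj m n h}"
  "Dom OSG = gdom" "Cod OSG = gcod" "Ident OSG = Ident FSG" "Comp OSG = Comp FSG"
  "gdom (arr m n h) = seg m" "gcod (arr m n h) = seg n"
  by (auto simp: OS_def FS_def ordered_surj_map_def)

lemma hom_set_OS: "hom_set OSG (seg m) (seg n) = arr m n ` {h. ordered_surj m n h}"
  by (auto simp: hom_set_def)

lemma hom_set_OS_subset: "hom_set OSG x y \<subseteq> hom_set FSG x y"
proof
  fix a assume "a \<in> hom_set OSG x y"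
  then obtain m n h where "a = arr m n h" "ordered_surj m n h" "x = seg m" "y = seg n"
    by (auto simp: hom_set_def)
  then show "a \<in> hom_set FSG x y" using arr_hom_FS by simp
qed

lemma category_OS: "category OSG"
proof -
  interpret FS: category FSG by (rule category_FS) (rule group_axioms)
  show ?thesis
  proof
    fix x y z f g assume "f \<in> hom_set OSG x y" "g \<in> hom_set OSG y z"
    then obtain m n p h k where "x = seg m" "y = seg n" "z = seg p" "ordered_surj m n h" "ordered_surj n p k"
        "f = arr m n h" "g = arr n p k"
      by (auto simp: hom_set_def)
    then show "Comp OSG g f \<in> hom_set OSG x z"
      using ordered_surj_comp[of m n h p k] by (auto simp: arr_comp hom_set_OS)
  next
    fix x assume "x \<in> Obj OSG"
    then show "Ident OSG x \<in> hom_set OSG x x" using ordered_surj_id by (auto simp: Ident_seg hom_set_OS)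
  next
    fix f x y assume "f \<in> hom_set OSG x y"
    then have "f \<in> hom_set FSG x y" using hom_set_OS_subset by blast
    then show "Comp OSG f (Ident OSG x) = f" "Comp OSG (Ident OSG y) f = f"
      using FS.Comp_Ident_right FS.Comp_Ident_left by auto
  next
    fix f g h w x y z
    assume "f \<in> hom_set OSG w x" "g \<in> hom_set OSG x y" "h \<in> hom_set OSG y z"
    then have "f \<in> hom_set FSG w x" "g \<in> hom_set FSG x y" "h \<in> hom_set FSG y z"
      using hom_set_OS_subset by blast+
    then show "Comp OSG h (Comp OSG g f) = Comp OSG (Comp OSG h g) f"
      using FS.Comp_assoc by simp
  qed auto
qed

text \<open>The lexicographic order on the ordered surjections onto the \<open>n\<close>-th segment. Since \<open>n\<close> stays fixed,
  this is the order needed on the arrows out of one object of the opposite category.\<close>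

definition lex_order :: "nat \<Rightarrow> 'a set \<Rightarrow> ('a, 'g) gmap rel" where
  "lex_order n y = {(arr m n f, arr m n g) | m f g.
     y = seg m \<and> ordered_surj m n f \<and> ordered_surj m n g \<and> ((\<forall>i<m. f i = g i) \<or> lex_less m f g)}"

lemma lex_order_iff:
  "ordered_surj m n f \<Longrightarrow> ordered_surj m n g \<Longrightarrow>
    (arr m n f, arr m n g) \<in> lex_order n (seg m) \<longleftrightarrow> (\<forall>i<m. f i = g i) \<or> lex_less m f g"
proof
  assume "(arr m n f, arr m n g) \<in> lex_order n (seg m)"
  then obtain f' g' where *: "\<forall>i<m. f i = f' i" "\<forall>i<m. g i = g' i"
      "(\<forall>i<m. f' i = g' i) \<or> lex_less m f' g'"
    by (auto simp: lex_order_def arr_eq_iff)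
  then show "(\<forall>i<m. f i = g i) \<or> lex_less m f g"
    using lex_less_cong[of m f' g' f g] by auto
qed (auto simp: lex_order_def)

lemma lex_orderE:
  assumes "(a, b) \<in> lex_order n (seg m)"
  obtains f g where "ordered_surj m n f" "ordered_surj m n g" "a = arr m n f" "b = arr m n g"
    "(\<forall>i<m. f i = g i) \<or> lex_less m f g"
  using assms by (auto simp: lex_order_def)

lemma well_order_lex_order: "well_order_on (hom_set OSG (seg m) (seg n)) (lex_order n (seg m))"
proof (rule finite_linear_order_on_imp_well_order_on)
  show "finite (hom_set OSG (seg m) (seg n))"
    using hom_set_OS_subset finite_hom_set_FS[OF finite_carrier]
    by (rule finite_subset) (auto simp: segment_def)
  let ?H = "hom_set OSG (seg m) (seg n)" and ?r = "lex_order n (seg m)"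
  have "?r \<subseteq> ?H \<times> ?H" by (auto simp: hom_set_OS elim!: lex_orderE)
  moreover have "\<forall>a\<in>?H. (a, a) \<in> ?r" by (auto simp: hom_set_OS lex_order_iff)
  moreover have "trans ?r"
  proof (rule transI)
    fix a b c assume "(a, b) \<in> ?r" "(b, c) \<in> ?r"
    then obtain f g g' h where *: "ordered_surj m n f" "ordered_surj m n h" "a = arr m n f" "c = arr m n h"
        "ordered_surj m n g" "b = arr m n g" "(a, b) \<in> ?r" "(b, c) \<in> ?r"
      by (metis lex_orderE)
    then have "(\<forall>i<m. f i = g i) \<or> lex_less m f g" "(\<forall>i<m. g i = h i) \<or> lex_less m g h"
      using lex_order_iff by auto
    then have "(\<forall>i<m. f i = h i) \<or> lex_less m f h"
      using lex_less_trans[of m f g h] lex_less_cong[of m g h f h] lex_less_cong[of m f g f h] by auto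
    then show "(a, c) \<in> ?r" using * by (simp add: lex_order_iff)
  qed
  moreover have "antisym ?r"
  proof (rule antisymI)
    fix a b assume r: "(a, b) \<in> ?r" "(b, a) \<in> ?r"
    then obtain f g where fg: "ordered_surj m n f" "ordered_surj m n g" "a = arr m n f" "b = arr m n g"
      by (metis lex_orderE)
    then have "(\<forall>i<m. f i = g i) \<or> lex_less m f g" "(\<forall>i<m. g i = f i) \<or> lex_less m g f"
      using r lex_order_iff by auto
    moreover have "\<not> (lex_less m f g \<and> lex_less m g f)"
      using lex_less_trans lex_less_irrefl by blast
    ultimately show "a = b" using fg by (auto simp: arr_eq_iff)
  qed
  moreover have "total_on ?H ?r"
  proof (rule total_onI)
    fix a b assume "a \<in> ?H" "b \<in> ?H" "a \<noteq> b"
    then obtain f g where "ordered_surj m n f" "ordered_surj m n g" "a = arr m n f" "b = arr m n g"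
        "\<exists>i<m. f i \<noteq> g i"
      by (auto simp: hom_set_OS arr_eq_iff)
    then show "(a, b) \<in> ?r \<or> (b, a) \<in> ?r" using lex_less_total by (auto simp: lex_order_iff)
  qed
  ultimately show "linear_order_on ?H ?r" by (auto simp: order_on_defs refl_on_def)
qed

lemma lex_order_comp:
  assumes "ordered_surj m' m k" and ab: "(a, b) \<in> lex_order n (seg m) - Id"
  shows "(Comp FSG a (arr m' m k), Comp FSG b (arr m' m k)) \<in> lex_order n (seg m') - Id"
proof -
  obtain f g where fg: "ordered_surj m n f" "ordered_surj m n g" "a = arr m n f" "b = arr m n g"
      "(\<forall>i<m. f i = g i) \<or> lex_less m f g"
    using ab lex_orderE by (metis DiffD1)
  then have "lex_less m f g" using ab by (auto simp: arr_eq_iff)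
  then have less: "lex_less m' (\<lambda>i. f (k i)) (\<lambda>i. g (k i))"
    using assms(1) by (rule lex_less_comp_ordered_surj)
  then have "\<exists>i<m'. f (k i) \<noteq> g (k i)" by (auto simp: lex_less_def)
  then show ?thesis
    using less fg ordered_surj_comp[OF assms(1)] by (auto simp: arr_comp[OF assms(1)] lex_order_iff arr_eq_iff)
qed

text \<open>An arrow out of \<open>seg n\<close> in the opposite category is a word in the alphabet \<open>{..<n}\<close>, and composing
  it with another arrow is precomposition by an ordered surjection.\<close>

lemma groebner_op_OS: "groebner (op_cat OSG)"
proof -
  have C: "category (op_cat OSG)" by (rule category_op_cat[OF category_OS])
  have op: "Obj (op_cat OSG) = range seg" "Dom (op_cat OSG) = gcod" "Cod (op_cat OSG) = gdom"
    "Comp (op_cat OSG) g f = Comp FSG f g" "Arr (op_cat OSG) = Arr OSG" for f g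
    by (auto simp: op_cat_def)
  show ?thesis
    unfolding groebner_def
  proof (intro conjI ballI C)
    fix x assume x: "x \<in> Obj (op_cat OSG)"
    then obtain n where n: "x = seg n" by (auto simp: op)
    show "orderable_at (op_cat OSG) x"
      unfolding orderable_at_def
    proof (intro exI[of _ "lex_order n"] conjI ballI allI impI)
      show "well_order_on (hom_set (op_cat OSG) x y) (lex_order n y)" if "y \<in> Obj (op_cat OSG)" for y
        using that well_order_lex_order by (auto simp: hom_set_op_cat n op)
      fix y z h f g
      assume "y \<in> Obj (op_cat OSG)" "z \<in> Obj (op_cat OSG)" "h \<in> hom_set (op_cat OSG) y z"
        "(f, g) \<in> lex_order n y - Id"
      moreover from this obtain m m' k where "y = seg m" "z = seg m'" "h = arr m' m k" "ordered_surj m' m k"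
        by (auto simp: hom_set_op_cat hom_set_OS op)
      ultimately show "(Comp (op_cat OSG) h f, Comp (op_cat OSG) h g) \<in> lex_order n z - Id"
        unfolding op by (metis lex_order_comp)
    qed
    show "noetherian_poset (poset_carrier (op_cat OSG) x) (poset_le (op_cat OSG) x)"
      unfolding noetherian_poset_def
    proof (intro allI impI)
      fix s assume s: "\<forall>i::nat. s i \<in> poset_carrier (op_cat OSG) x"
      note eqv = equiv_factor_equiv[OF C x]
      have "\<exists>m f. ordered_surj m n f \<and> arr m n f \<in> s i" for i
      proof -
        obtain a where a: "a \<in> arrows_from (op_cat OSG) x" "s i = factor_equiv (op_cat OSG) x `` {a}"
          using s unfolding poset_carrier_def by (metis quotientE)
        have "a \<in> s i" using equiv_class_self[OF eqv a(1)] a(2) by simp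
        moreover obtain m f where "ordered_surj m n f" "a = arr m n f"
          using a(1) by (auto simp: arrows_from_def op n)
        ultimately show ?thesis by blast
      qed
      then obtain m f where mf: "\<And>i. ordered_surj (m i) n (f i)" "\<And>i. arr (m i) n (f i) \<in> s i" by metis
      obtain i j h where h: "i < j" "ordered_surj (m j) (m i) h" "\<And>x. x < m j \<Longrightarrow> f j x = f i (h x)"
        using ordered_surj_good_pair[OF mf(1)] by blast
      have "arr (m j) n (f j) = Comp FSG (arr (m i) n (f i)) (arr (m j) (m i) h)"
        using h(3) by (simp add: arr_comp[OF h(2)] arr_eq_iff)
      moreover have "arr (m j) (m i) h \<in>
          hom_set (op_cat OSG) (gdom (arr (m i) n (f i))) (gdom (arr (m j) n (f j)))"
        using h(2) by (simp add: hom_set_op_cat hom_set_OS)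
      moreover have "arr (m k) n (f k) \<in> arrows_from (op_cat OSG) x" for k
        using mf(1) by (auto simp: arrows_from_def op n)
      ultimately have "(arr (m i) n (f i), arr (m j) n (f j)) \<in> factor_preorder (op_cat OSG) x"
        unfolding factor_preorder_def op by blast
      then have "(s i, s j) \<in> poset_le (op_cat OSG) x"
        using s mf(2) unfolding poset_le_def by blast
      then show "\<exists>i j. i < j \<and> (s i, s j) \<in> poset_le (op_cat OSG) x" using h(1) by blast
    qed
  qed
qed

definition inclusion :: "('a set, ('a, 'g) gmap, 'a set, ('a, 'g) gmap) func" where
  "inclusion = \<lparr>on_obj = (\<lambda>x. x), on_arr = (\<lambda>f. f)\<rparr>"

lemma is_functor_inclusion: "is_functor (op_cat OSG) (op_cat FSG) inclusion"
proof -
  have "f \<in> hom_set FSG (gdom f) (gcod f)" if "f \<in> Arr OSG" for f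
    using that hom_set_OS_subset[of "gdom f" "gcod f"] by (auto simp: hom_set_def)
  then show ?thesis
    by (auto simp: is_functor_def inclusion_def op_cat_def hom_set_def segment_def FS_def)
qed

text \<open>A finite set is isomorphic to the segment of the same cardinality, by a bijection with trivial
  weights.\<close>

lemma essentially_surjective_inclusion:
  "essentially_surjective (op_cat OSG) (op_cat FSG) inclusion"
  unfolding essentially_surjective_def
proof
  fix R :: "'a set" assume "R \<in> Obj (op_cat FSG)"
  then have fin: "finite R" by (simp add: op_cat_def FS_def)
  have fs: "finite (seg n)" for n by (simp add: segment_def)
  have "card (seg (card R)) = card R"
    using card_image[of e "{..<card R}"] inj_on_subset[OF inj_e] by (simp add: segment_def)
  then obtain b where b: "bij_betw b (seg (card R)) R"
    using finite_same_card_bij[OF fs fin] by blast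
  let ?S = "seg (card R)"
  let ?c = "inv_into ?S b"
  have c: "bij_betw ?c R ?S" by (rule bij_betw_inv_into[OF b])
  define f where "f = GMap ?S R (restrict b ?S) (\<lambda>x\<in>?S. \<one>)"
  define g where "g = GMap R ?S (restrict ?c R) (\<lambda>x\<in>R. \<one>)"
  have f: "f \<in> hom_set FSG ?S R"
    using b fs fin by (auto simp: hom_set_FS f_def bij_betw_def)
  have g: "g \<in> hom_set FSG R ?S"
    using c fs fin by (auto simp: hom_set_FS g_def bij_betw_def)
  have "Comp FSG g f = Ident FSG ?S"
    using b bij_betw_inv_into_left[OF b]
    by (auto simp: FS_def f_def g_def fun_eq_iff restrict_def bij_betw_def)
  moreover have "Comp FSG f g = Ident FSG R"
    using c bij_betw_inv_into_right[OF b] bij_betwE[OF c]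
    by (auto simp: FS_def f_def g_def fun_eq_iff restrict_def)
  ultimately have "isomorphic (op_cat FSG) ?S R"
    unfolding isomorphic_def hom_set_op_cat using f g by (auto simp: op_cat_def)
  then show "\<exists>x\<in>Obj (op_cat OSG). isomorphic (op_cat FSG) (on_obj inclusion x) R"
    by (auto simp: op_cat_def inclusion_def)
qed

text \<open>A G-map \<open>(f, \<rho>)\<close> to \<open>R\<close> is determined by the function \<open>q = (f, \<rho>)\<close> to \<open>R \<times> G\<close>. Numbering the
  values of \<open>q\<close> by first occurrence, \<open>q\<close> becomes an ordered surjection \<open>g\<close> followed by an injection
  \<open>c\<close>, and \<open>c\<close> is again a G-map to \<open>R\<close>. As \<open>G\<close> is finite, the size of its source is bounded.\<close>

lemma FS_factorization:
  assumes a: "a \<in> hom_set FSG (seg m) R"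
  obtains p b g where "p \<le> card R * card (carrier G)" "b \<in> hom_set FSG (seg p) R"
    "ordered_surj m p g" "a = Comp FSG b (arr m p g)"
proof -
  obtain f \<rho> where f: "a = GMap (seg m) R f \<rho>" "finite R" "f \<in> seg m \<rightarrow>\<^sub>E R" "f ` seg m = R"
      "\<rho> \<in> seg m \<rightarrow>\<^sub>E carrier G"
    using a unfolding hom_set_FS by blast
  define q where "q i = (f (e i), \<rho> (e i))" for i
  obtain p g c where g: "ordered_surj m p g" and c: "bij_betw c {..<p} (q ` {..<m})"
      and q: "\<And>i. i < m \<Longrightarrow> q i = c (g i)"
    using ordered_surj_factorization[of m q] by blast
  have sub: "q ` {..<m} \<subseteq> R \<times> carrier G"
    using f(3,5) by (auto simp: q_def PiE_iff)
  have "p = card (q ` {..<m})" using bij_betw_same_card[OF c] by simp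
  also have "\<dots> \<le> card (R \<times> carrier G)"
    by (rule card_mono[OF _ sub]) (use f(2) finite_carrier in auto)
  finally have p: "p \<le> card R * card (carrier G)" by (simp add: card_cartesian_product)
  define b where "b = GMap (seg p) R (\<lambda>x\<in>seg p. fst (c (the_inv e x))) (\<lambda>x\<in>seg p. snd (c (the_inv e x)))"
  have c_in: "c i \<in> R \<times> carrier G" if "i < p" for i
    using that bij_betwE[OF c] sub by blast
  have "(\<lambda>x\<in>seg p. fst (c (the_inv e x))) ` seg p = fst ` c ` {..<p}"
    unfolding segment_def image_image by (rule image_cong) auto
  also have "\<dots> = fst ` q ` {..<m}" using c by (simp add: bij_betw_def)
  also have "\<dots> = f ` seg m" by (simp add: q_def segment_def image_image)
  finally have "(\<lambda>x\<in>seg p. fst (c (the_inv e x))) ` seg p = R" using f(4) by simp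
  moreover have "(\<lambda>x\<in>seg p. fst (c (the_inv e x))) \<in> seg p \<rightarrow>\<^sub>E R"
      "(\<lambda>x\<in>seg p. snd (c (the_inv e x))) \<in> seg p \<rightarrow>\<^sub>E carrier G"
    using c_in by (auto simp: segment_def mem_Times_iff)
  ultimately have b: "b \<in> hom_set FSG (seg p) R"
    unfolding hom_set_FS b_def using f(2) by (auto simp: segment_def)
  have "a = Comp FSG b (arr m p g)"
  proof -
    have "f x = (\<lambda>x\<in>seg m. (\<lambda>x\<in>seg p. fst (c (the_inv e x))) ((\<lambda>x\<in>seg m. e (g (the_inv e x))) x)) x" for x
    proof (cases "x \<in> seg m")
      case True
      then obtain i where "i < m" "x = e i" by (auto simp: segment_def)
      then show ?thesis using ordered_surj_lt[OF g] q[of i, symmetric] by (simp add: q_def)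
    qed (use f(3) in \<open>auto simp: PiE_iff extensional_def\<close>)
    moreover have "\<rho> x = (\<lambda>x\<in>seg m. (\<lambda>x\<in>seg p. snd (c (the_inv e x))) ((\<lambda>x\<in>seg m. e (g (the_inv e x))) x)
        \<otimes> (\<lambda>x\<in>seg m. \<one>) x) x" for x
    proof (cases "x \<in> seg m")
      case True
      then obtain i where i: "i < m" "x = e i" by (auto simp: segment_def)
      have "\<rho> x \<in> carrier G" using f(5) True by auto
      then show ?thesis using ordered_surj_lt[OF g] q[of i, symmetric] i by (simp add: q_def)
    qed (use f(5) in \<open>auto simp: PiE_iff extensional_def\<close>)
    ultimately show ?thesis unfolding f(1) by (simp add: FS_def b_def ordered_surj_map_def fun_eq_iff)
  qed
  then show thesis using that p b g by blast
qed

text \<open>By the factorization above, the G-maps to \<open>R\<close> from the finitely many segments of size at most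
  \<open>\<bar>R\<bar> \<cdot> \<bar>G\<bar>\<close> suffice.\<close>

lemma property_F_inclusion: "property_F (op_cat OSG) (op_cat FSG) inclusion"
  unfolding property_F_def
proof
  fix R :: "'a set" assume "R \<in> Obj (op_cat FSG)"
  then have fin: "finite R" by (simp add: op_cat_def FS_def)
  let ?Y = "SIGMA p:{..card R * card (carrier G)}. hom_set FSG (seg p) R"
  have "finite ?Y"
    using finite_hom_set_FS[OF finite_carrier _ fin] by (intro finite_SigmaI) (auto simp: segment_def)
  then obtain n :: nat and t where t: "?Y = t ` {i. i < n}"
    using finite_imp_nat_seg_image_inj_on by metis
  have "\<forall>i<n. seg (fst (t i)) \<in> Obj (op_cat OSG) \<and>
      snd (t i) \<in> hom_set (op_cat FSG) R (on_obj inclusion (seg (fst (t i))))"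
  proof (intro allI impI)
    fix i assume "i < n"
    then have "t i \<in> ?Y" unfolding t by blast
    then show "seg (fst (t i)) \<in> Obj (op_cat OSG) \<and>
        snd (t i) \<in> hom_set (op_cat FSG) R (on_obj inclusion (seg (fst (t i))))"
      by (auto simp: op_cat_def[of OSG] hom_set_op_cat inclusion_def)
  qed
  moreover have "\<forall>z\<in>Obj (op_cat OSG). \<forall>h\<in>hom_set (op_cat FSG) R (on_obj inclusion z).
      \<exists>i<n. \<exists>g\<in>hom_set (op_cat OSG) (seg (fst (t i))) z.
        h = Comp (op_cat FSG) (on_arr inclusion g) (snd (t i))"
  proof (intro ballI)
    fix z h
    assume z: "z \<in> Obj (op_cat OSG)" and h: "h \<in> hom_set (op_cat FSG) R (on_obj inclusion z)"
    obtain m where m: "z = seg m" using z by (auto simp: op_cat_def)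
    have "h \<in> hom_set FSG (seg m) R" using h by (simp add: hom_set_op_cat inclusion_def m)
    then obtain p b g where *: "p \<le> card R * card (carrier G)" "b \<in> hom_set FSG (seg p) R"
        "ordered_surj m p g" "h = Comp FSG b (arr m p g)"
      by (rule FS_factorization)
    then have "(p, b) \<in> ?Y" by simp
    then obtain i where i: "i < n" "t i = (p, b)" unfolding t by auto
    have "arr m p g \<in> hom_set (op_cat OSG) (seg (fst (t i))) z"
      using *(3) i(2) by (simp add: hom_set_op_cat hom_set_OS m)
    moreover have "h = Comp (op_cat FSG) (on_arr inclusion (arr m p g)) (snd (t i))"
      using *(4) i(2) by (simp add: op_cat_def inclusion_def)
    ultimately show "\<exists>i<n. \<exists>g\<in>hom_set (op_cat OSG) (seg (fst (t i))) z.
        h = Comp (op_cat FSG) (on_arr inclusion g) (snd (t i))"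
      using i(1) by blast
  qed
  ultimately show "\<exists>(n::nat) y f. (\<forall>i<n. y i \<in> Obj (op_cat OSG) \<and> f i \<in> hom_set (op_cat FSG) R (on_obj inclusion (y i))) \<and>
      (\<forall>z\<in>Obj (op_cat OSG). \<forall>h\<in>hom_set (op_cat FSG) R (on_obj inclusion z).
        \<exists>i<n. \<exists>g\<in>hom_set (op_cat OSG) (y i) z. h = Comp (op_cat FSG) (on_arr inclusion g) (f i))"
    by (intro exI[of _ n] exI[of _ "\<lambda>i. seg (fst (t i))"] exI[of _ "\<lambda>i. snd (t i)"] conjI)
qed

theorem quasi_groebner_op_FS: "quasi_groebner TYPE('a set) TYPE(('a, 'g) gmap) (op_cat FSG)"
  unfolding quasi_groebner_def
  using category_op_cat[OF category_FS[OF group_axioms]] groebner_op_OS is_functor_inclusion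
    essentially_surjective_inclusion property_F_inclusion
  by blast

end

theorem theorem1p3p1:
  fixes G :: "('g, 'e) monoid_scheme"
  assumes "group G" and "finite (carrier G)"
    and "infinite (UNIV :: 'a set)"
  shows "quasi_groebner TYPE('a set) TYPE(('a, 'g) gmap)
           (op_cat (FS G :: ('a set, ('a, 'g) gmap) cat)) \<and>
         (\<forall>k :: ('k, 'z) ring_scheme.
            ring k \<and> \<one>\<^bsub>k\<^esub> \<noteq> \<zero>\<^bsub>k\<^esub> \<and> left_noetherian k \<longrightarrow>
            noetherian_Rep TYPE('v) k (op_cat (FS G :: ('a set, ('a, 'g) gmap) cat)))"
proof -
  obtain e :: "nat \<Rightarrow> 'a" where "inj e"
    using infinite_countable_subset[OF assms(3)] by blast
  then interpret segments G e
    using assms by (simp add: segments_def segments_axioms_def)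
  show ?thesis
    using quasi_groebner_op_FS quasi_groebner_imp_noetherian_Rep[OF quasi_groebner_op_FS] by blast
qed

end
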